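(* Suppose $\mathcal{Q}$ is a Glivenko--Cantelli--Donsker (GCD) class of measures and $(k_N)_{N\in\mathbb{N}}$ is a sequence of positive reals with $k_N=o(N)$. Let $\xi=\phi(X)$, where $\phi$ is a bounded measurable function and $X,\{X_n\}_{n\in\mathbb{N}}$ are iid under every $Q\in\mathcal{Q}$. (i) $\mathcal{E}^{k_N,1}_{\mathcal{Q}|\mathbf{x}_N}$ is a consistent estimator, that is, for every $P\in\mathcal{Q}$, $\mathcal{E}^{k_N,1}_{\mathcal{Q}|\mathbf{x}_N}(\xi)\to E_P[\xi]$ in $P$-probability as $N\to\infty$. (ii) For each $P\in\mathcal{Q}$, as $N\to\infty$, $$\mathcal{E}^{k_N,1}_{\mathcal{Q}|\mathbf{x}_N}(\xi)\le E_P[\xi]+\frac{k_N}{N}\,\frac12\,\mathrm{Var}_P(\xi)+O\Big(\Big(\frac{k_N}{N}\Big)^2\Big)+O_P\Big(\frac{N^{1/2}}{k_N}\Big),$$ with equality whenever $P$ is such that, for all $N$ sufficiently large, the measure $\tilde P$ with density $$f(x;\tilde P)=\frac{f(x;P)}{\lambda-\frac{k_N}{N}\phi(x)}$$ (where $\lambda>\frac{k_N}{N}\sup_x\phi(x)$ is chosen to ensure this is a probability density) is also in $\mathcal{Q}$.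
   Context: Setting. $\mathcal{Q}$ is a family of probability measures on a measurable space carrying real random variables $X,X_1,X_2,\dots$; under each $Q\in\mathcal{Q}$ the variables $X,\{X_n\}_{n\in\mathbb{N}}$ are iid with density $f(\cdot;Q)$ with respect to Lebesgue measure. A measure in $\mathcal{Q}$ is identified by this density. Write $\mathbf{x}_N=(X_1,\dots,X_N)$ and $L(Q|\mathbf{x}_N)=\prod_{n=1}^N f(X_n;Q)$. It is assumed that the $\mathcal{Q}$-MLE $\hat Q_N$ exists, i.e. there is a measurable map $\mathbf{x}_N\mapsto\hat Q_N\in\mathcal{Q}$ with $L(\hat Q_N|\mathbf{x}_N)\ge L(Q|\mathbf{x}_N)$ for all $Q\in\mathcal{Q}$. Divergence: $\alpha_{\mathcal{Q}|\mathbf{x}_N}(Q)=-\log L(Q|\mathbf{x}_N)+\sup_{\tilde Q\in\mathcal{Q}}\log L(\tilde Q|\mathbf{x}_N)$. DR-expectation: for $k>0$, $\mathcal{E}^{k,1}_{\mathcal{Q}|\mathbf{x}_N}(\xi)=\sup_{Q\in\mathcal{Q}}\{E_Q[\xi|\mathbf{x}_N]-\frac1k\alpha_{\mathcal{Q}|\mathbf{x}_N}(Q)\}$; for $\xi=\phi(X)$, $E_Q[\xi|\mathbf{x}_N]=E_Q[\phi(X)]$ by independence. Relative entropy of the law of $X$: $D_{\mathrm{KL}|X}(P||Q)=\int\log\big(\frac{f(x;P)}{f(x;Q)}\big)f(x;P)\,dx$. $O_P$ notation: $Y_N=O_P(g(N))$ means $\lim_{M\to\infty}\limsup_{N\to\infty}P(|Y_N/g(N)|>M)=0$.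 $O(\cdot)$ and $o(\cdot)$ are the usual deterministic notions. GCD class: $\mathcal{Q}$ is a GCD class if, for any $P\in\mathcal{Q}$, $$\sup^*_{Q\in\mathcal{Q}}\Big|\frac{\alpha_{\mathcal{Q}|\mathbf{x}_N}(Q)}{N}-D_{\mathrm{KL}|X}(P||Q)\Big|=O_P(N^{-1/2}),$$ where $\sup^*$ is the minimal measurable envelope of the supremum. *)

theory Defs
  imports "HOL-Probability.Probability" "HOL-Library.Landau_Symbols"
begin

text \<open>
  The family \<open>\<Q>\<close> consists of probability measures on the measurable space underlying \<open>M\<close>; the
  measure carried by \<open>M\<close> itself is irrelevant.  For each \<open>Q\<close> the function \<open>f Q\<close> is one fixed
  version of the density; likelihoods are evaluated with this version.  \<open>X\<close> is the unobserved
  variable and \<open>Xs 1, Xs 2, \<dots>\<close> are the observations; \<open>Xs 0\<close> plays no role.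
\<close>

definition iid_family ::
  "'a measure \<Rightarrow> 'a measure set \<Rightarrow> ('a \<Rightarrow> real) \<Rightarrow> (nat \<Rightarrow> 'a \<Rightarrow> real) \<Rightarrow> ('a measure \<Rightarrow> real \<Rightarrow> real) \<Rightarrow> bool"
where
  "iid_family M \<Q> X Xs f \<longleftrightarrow>
     (\<forall>Q\<in>\<Q>. prob_space Q \<and> sets Q = sets M \<and>
        prob_space.indep_vars Q (\<lambda>_. borel) (\<lambda>n. if n = 0 then X else Xs n) UNIV \<and>
        f Q \<in> borel_measurable borel \<and> (\<forall>x. 0 \<le> f Q x) \<and>
        distributed Q lborel X (\<lambda>x. ennreal (f Q x)) \<and>
        (\<forall>n\<ge>1. distributed Q lborel (Xs n) (\<lambda>x. ennreal (f Q x)))) \<and>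
     (\<forall>Q\<in>\<Q>. \<forall>Q'\<in>\<Q>. (AE x in lborel. f Q x = f Q' x) \<longrightarrow> Q = Q')"

definition sample :: "(nat \<Rightarrow> 'a \<Rightarrow> real) \<Rightarrow> nat \<Rightarrow> 'a \<Rightarrow> (nat \<Rightarrow> real)" where
  "sample Xs N \<omega> = (\<lambda>n\<in>{1..N}. Xs n \<omega>)"

definition likelihood :: "('b \<Rightarrow> real \<Rightarrow> real) \<Rightarrow> nat \<Rightarrow> (nat \<Rightarrow> real) \<Rightarrow> 'b \<Rightarrow> real" where
  "likelihood f N x Q = (\<Prod>n\<in>{1..N}. f Q (x n))"

definition log_likelihood :: "('b \<Rightarrow> real \<Rightarrow> real) \<Rightarrow> nat \<Rightarrow> (nat \<Rightarrow> real) \<Rightarrow> 'b \<Rightarrow> ereal" where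
  "log_likelihood f N x Q =
     (if likelihood f N x Q = 0 then -\<infinity> else ereal (ln (likelihood f N x Q)))"

text \<open>
  Existence of a maximum likelihood estimator that is a measurable function of the sample; \<open>\<Q>\<close>
  carries the \<open>\<sigma>\<close>-algebra generated by the evaluations \<open>Q \<mapsto> Q A\<close>.
\<close>

definition mle_exists ::
  "'a measure \<Rightarrow> 'a measure set \<Rightarrow> (nat \<Rightarrow> 'a \<Rightarrow> real) \<Rightarrow> ('a measure \<Rightarrow> real \<Rightarrow> real) \<Rightarrow> bool"
where
  "mle_exists M \<Q> Xs f \<longleftrightarrow>
     (\<forall>N\<ge>1. \<exists>Qhat \<in> measurable (\<Pi>\<^sub>M n\<in>{1..N}. borel) (restrict_space (prob_algebra M) \<Q>).
        \<forall>\<omega>\<in>space M. \<forall>Q\<in>\<Q>.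
          likelihood f N (sample Xs N \<omega>) Q
            \<le> likelihood f N (sample Xs N \<omega>) (Qhat (sample Xs N \<omega>)))"

definition divergence ::
  "'b set \<Rightarrow> ('b \<Rightarrow> real \<Rightarrow> real) \<Rightarrow> nat \<Rightarrow> (nat \<Rightarrow> real) \<Rightarrow> 'b \<Rightarrow> ereal"
where
  "divergence \<Q> f N x Q = - log_likelihood f N x Q + (SUP Q'\<in>\<Q>. log_likelihood f N x Q')"

text \<open>
  The DR-expectation of a random variable \<open>\<xi>\<close> that is independent of the sample under every
  \<open>Q \<in> \<Q>\<close>, so that \<open>E\<^sub>Q[\<xi>]\<close> is a version of \<open>E\<^sub>Q[\<xi> | x\<^sub>N]\<close>;
  the lemma \<open>cond_exp_sample\<close> below confirms this for \<open>\<xi> = \<phi>(X)\<close>.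
\<close>

definition dr_expectation ::
  "'a measure set \<Rightarrow> ('a measure \<Rightarrow> real \<Rightarrow> real) \<Rightarrow> nat \<Rightarrow> (nat \<Rightarrow> real) \<Rightarrow> real \<Rightarrow> ('a \<Rightarrow> real) \<Rightarrow> ereal"
where
  "dr_expectation \<Q> f N x k \<xi> =
     (SUP Q\<in>\<Q>. ereal (prob_space.expectation Q \<xi>) - ereal (1 / k) * divergence \<Q> f N x Q)"

text \<open>
  Relative entropy in \<open>[0, \<infinity>]\<close>, as the extended integral of the integrand with the conventions
  \<open>0 log (0 / q) = 0\<close> and \<open>p log (p / 0) = \<infinity>\<close> for \<open>p > 0\<close>.  (The library's
  \<^const>\<open>KL_divergence\<close> is real-valued and returns \<open>0\<close> when the integral diverges.)
  Since \<^const>\<open>e2ennreal\<close> truncates at \<open>0\<close>, the two terms are the integrals of the positive and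
  negative parts; the latter is finite for probability densities.
\<close>

definition KL_integrand :: "(real \<Rightarrow> real) \<Rightarrow> (real \<Rightarrow> real) \<Rightarrow> real \<Rightarrow> ereal" where
  "KL_integrand p q x =
     (if p x = 0 then 0 else if q x = 0 then \<infinity> else ereal (ln (p x / q x) * p x))"

definition KL :: "(real \<Rightarrow> real) \<Rightarrow> (real \<Rightarrow> real) \<Rightarrow> ereal" where
  "KL p q =
     enn2ereal (\<integral>\<^sup>+x. e2ennreal (KL_integrand p q x) \<partial>lborel)
       - enn2ereal (\<integral>\<^sup>+x. e2ennreal (- KL_integrand p q x) \<partial>lborel)"

text \<open>
  \<open>U\<close> is a minimal measurable envelope (measurable cover) of \<open>g\<close> under \<open>P\<close>; it always exists and
  is unique up to \<open>P\<close>-null sets.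
\<close>

definition measurable_envelope :: "'a measure \<Rightarrow> ('a \<Rightarrow> ereal) \<Rightarrow> ('a \<Rightarrow> ereal) \<Rightarrow> bool" where
  "measurable_envelope P g U \<longleftrightarrow>
     U \<in> borel_measurable P \<and> (\<forall>\<omega>\<in>space P. g \<omega> \<le> U \<omega>) \<and>
     (\<forall>V \<in> borel_measurable P. (AE \<omega> in P. g \<omega> \<le> V \<omega>) \<longrightarrow> (AE \<omega> in P. U \<omega> \<le> V \<omega>))"

text \<open>
  The DR-expectation is a supremum over a possibly uncountable family and need not be measurable.
  Stochastic orders and convergence in probability are therefore stated with the outer measure,
  which is \<open>P\<close> itself on measurable events.
\<close>

definition bigO_P :: "'a measure \<Rightarrow> (nat \<Rightarrow> 'a \<Rightarrow> ereal) \<Rightarrow> (nat \<Rightarrow> real) \<Rightarrow> bool" where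
  "bigO_P P Y g \<longleftrightarrow>
     ((\<lambda>C::real. limsup (\<lambda>N. outer_measure_of P {\<omega>\<in>space P. \<bar>Y N \<omega> / ereal (g N)\<bar> > ereal C}))
        \<longlongrightarrow> 0) at_top"

definition tendsto_in_prob :: "'a measure \<Rightarrow> (nat \<Rightarrow> 'a \<Rightarrow> ereal) \<Rightarrow> real \<Rightarrow> bool" where
  "tendsto_in_prob P Y c \<longleftrightarrow>
     (\<forall>\<epsilon>::real. 0 < \<epsilon> \<longrightarrow>
        (\<lambda>N. outer_measure_of P {\<omega>\<in>space P. \<bar>Y N \<omega> - ereal c\<bar> > ereal \<epsilon>}) \<longlonglongrightarrow> 0)"

text \<open>
  Absolute difference of extended reals, with \<open>|\<infinity> - \<infinity>|\<close> read as \<open>0\<close> (in \<^typ>\<open>ereal\<close> it would be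
  \<open>\<infinity>\<close>): measures \<open>Q\<close> with \<open>\<alpha>(Q) = \<infinity> = D(P || Q)\<close> do not spoil the uniform approximation below.
\<close>

definition ext_dist :: "ereal \<Rightarrow> ereal \<Rightarrow> ereal" where
  "ext_dist a b = (if a = b then 0 else \<bar>a - b\<bar>)"

definition GCD_class ::
  "'a measure set \<Rightarrow> (nat \<Rightarrow> 'a \<Rightarrow> real) \<Rightarrow> ('a measure \<Rightarrow> real \<Rightarrow> real) \<Rightarrow> bool"
where
  "GCD_class \<Q> Xs f \<longleftrightarrow>
     (\<forall>P\<in>\<Q>. \<exists>U.
        (\<forall>N\<ge>1. measurable_envelope P
           (\<lambda>\<omega>. SUP Q\<in>\<Q>. ext_dist (divergence \<Q> f N (sample Xs N \<omega>) Q / ereal (real N)) (KL (f P) (f Q)))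
           (U N)) \<and>
        bigO_P P U (\<lambda>N. real N powr (-1/2)))"

lemma cond_exp_sample:
  fixes X :: "'a \<Rightarrow> real" and Xs :: "nat \<Rightarrow> 'a \<Rightarrow> real" and \<phi> :: "real \<Rightarrow> real" and N :: nat
  assumes fam: "iid_family M \<Q> X Xs f" and Q: "Q \<in> \<Q>"
    and \<phi>: "\<phi> \<in> borel_measurable borel" "bounded (range \<phi>)"
  defines "F \<equiv> vimage_algebra (space Q) (sample Xs N) (\<Pi>\<^sub>M n\<in>{1..N}. borel)"
  shows "AE \<omega> in Q. real_cond_exp Q F (\<lambda>\<omega>. \<phi> (X \<omega>)) \<omega> = prob_space.expectation Q (\<lambda>\<omega>. \<phi> (X \<omega>))"
proof -
  interpret prob_space Q using fam Q by (auto simp: iid_family_def)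
  let ?Z = "\<lambda>n. if n = 0 then X else Xs n"
  let ?PI = "\<Pi>\<^sub>M n\<in>{1..N}. (borel :: real measure)"
  have indep: "indep_vars (\<lambda>_. borel) ?Z UNIV"
    using fam Q by (auto simp: iid_family_def)
  have "indep_var (PiM {1..N} (\<lambda>_. borel)) (\<lambda>\<omega>. restrict (\<lambda>i. ?Z i \<omega>) {1..N})
          (PiM {0} (\<lambda>_. borel)) (\<lambda>\<omega>. restrict (\<lambda>i. ?Z i \<omega>) {0})"
    by (rule indep_var_restrict[OF indep]) auto
  moreover have "(\<lambda>\<omega>. restrict (\<lambda>i. ?Z i \<omega>) {1..N}) = sample Xs N"
    by (auto simp: sample_def fun_eq_iff restrict_def)
  ultimately have ind: "indep_var ?PI (sample Xs N)
      (PiM {0} (\<lambda>_. borel)) (\<lambda>\<omega>. restrict (\<lambda>i. ?Z i \<omega>) {0::nat})" by simp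
  have X[measurable]: "X \<in> borel_measurable Q"
    using fam Q by (auto simp: iid_family_def distributed_def)
  have S[measurable]: "sample Xs N \<in> measurable Q ?PI"
    using ind unfolding indep_var_eq by blast
  note \<phi>(1)[measurable]
  obtain B where B: "\<And>x. \<bar>\<phi> x\<bar> \<le> B"
    using \<phi>(2) by (auto simp: bounded_iff)
  have int: "integrable Q (\<lambda>\<omega>. \<phi> (X \<omega>))"
    by (rule integrable_const_bound[where B = B]) (use B in auto)
  have sets_F: "sets F = {sample Xs N -` A \<inter> space Q | A. A \<in> sets ?PI}"
    unfolding F_def by (rule sets_vimage_algebra2) (use measurable_space[OF S] in blast)
  have sub: "subalgebra Q F"
    unfolding subalgebra_def sets_F by (auto simp: F_def measurable_sets[OF S])
  interpret finite_measure_subalgebra Q F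
    by standard (rule sub)
  show ?thesis
  proof (rule real_cond_exp_charact)
    fix A assume "A \<in> sets F"
    then obtain A' where A'[measurable]: "A' \<in> sets ?PI" and A: "A = sample Xs N -` A' \<inter> space Q"
      unfolding sets_F by blast
    have A_sets[measurable]: "A \<in> sets Q"
      unfolding A by (rule measurable_sets[OF S A'])
    have "indep_var borel ((indicator A' :: _ \<Rightarrow> real) \<circ> sample Xs N)
        borel ((\<lambda>g. \<phi> (g 0)) \<circ> (\<lambda>\<omega>. restrict (\<lambda>i. ?Z i \<omega>) {0::nat}))"
      by (rule indep_var_compose[OF ind]) measurable
    moreover have "(\<lambda>g. \<phi> (g 0)) \<circ> (\<lambda>\<omega>. restrict (\<lambda>i. ?Z i \<omega>) {0::nat}) = (\<lambda>\<omega>. \<phi> (X \<omega>))"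
      by auto
    ultimately have ind': "indep_var borel (\<lambda>\<omega>. indicator A' (sample Xs N \<omega>) :: real)
        borel (\<lambda>\<omega>. \<phi> (X \<omega>))"
      by (simp add: o_def)
    have intA: "integrable Q (\<lambda>\<omega>. indicator A' (sample Xs N \<omega>) :: real)"
      by (rule integrable_const_bound[where B = 1]) (auto simp: indicator_def)
    have ind_eq: "indicator A \<omega> = (indicator A' (sample Xs N \<omega>) :: real)" if "\<omega> \<in> space Q" for \<omega>
      using that by (auto simp: A indicator_def)
    have "(LINT x:A|Q. \<phi> (X x)) = (LINT \<omega>|Q. indicator A' (sample Xs N \<omega>) * \<phi> (X \<omega>))"
      unfolding set_lebesgue_integral_def
      by (rule Bochner_Integration.integral_cong) (simp_all add: ind_eq)
    also have "\<dots> = (LINT \<omega>|Q. indicator A' (sample Xs N \<omega>)) * expectation (\<lambda>\<omega>. \<phi> (X \<omega>))"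
      by (rule indep_var_lebesgue_integral[OF ind' intA int])
    also have "\<dots> = (LINT x:A|Q. expectation (\<lambda>\<omega>. \<phi> (X \<omega>)))"
    proof -
      have "(LINT \<omega>|Q. indicator A' (sample Xs N \<omega>)) = (LINT \<omega>|Q. (indicator A \<omega> :: real))"
        by (rule Bochner_Integration.integral_cong) (simp_all add: ind_eq)
      then show ?thesis by (simp add: set_lebesgue_integral_def)
    qed
    finally show "(LINT x:A|Q. \<phi> (X x)) = (LINT x:A|Q. expectation (\<lambda>\<omega>. \<phi> (X \<omega>)))" .
  qed (use int in auto)
qed

end

theory Submission
  imports Defs
begin

text \<open>
  Write \<open>e = k/N\<close>.  For \<open>\<lambda> > e sup \<phi>\<close>, integrating \<open>ln t \<le> t - 1\<close> at \<open>t = (\<lambda> - e \<phi>) f\<^sub>Q / f\<^sub>P\<close>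
  against \<open>f\<^sub>P\<close> gives the weak duality
  \<open>E\<^sub>Q[\<phi>] - D(P || Q) / e \<le> (\<lambda> - 1 - E\<^sub>P[ln (\<lambda> - e \<phi>)]) / e\<close>, with equality when
  \<open>f\<^sub>Q = f\<^sub>P / (\<lambda> - e \<phi>)\<close>.  A second-order expansion of the logarithm turns the right-hand side
  into \<open>E\<^sub>P[\<phi>] + (e/2) Var\<^sub>P(\<phi>) + (\<lambda> - 1 - e E\<^sub>P[\<phi>])\<^sup>2 / (2e) + O(e\<^sup>2)\<close>.  Taking
  \<open>\<lambda> = 1 + e E\<^sub>P[\<phi>]\<close> gives the upper bound; for the normalising \<open>\<lambda>\<close> of the tilted density the
  square is nonnegative, which gives the matching lower bound.  The GCD property replaces
  \<open>\<alpha>/N\<close> by \<open>D(P || Q)\<close> at the cost of \<open>O\<^sub>P(N\<^sup>-\<^sup>1\<^sup>/\<^sup>2) / e\<close>.  For consistency the same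
  duality at a fixed small \<open>e\<close> plays the role of Pinsker's inequality: it bounds
  \<open>|E\<^sub>Q[\<phi>] - E\<^sub>P[\<phi>]|\<close> by \<open>D(P || Q) / e + O(e)\<close>.
\<close>

section \<open>Logarithm expansion and integrals against a density\<close>

text \<open>The remainder \<open>F\<close> has derivative \<open>x^2 / (1 + x)\<close>, at most
  \<open>2 * u^2\<close> for |x| \<le> |u| because \<open>1 + x\<close> is at least 1/2 there; the
  mean value inequality between 0 and \<open>u\<close> supplies the third factor.\<close>

lemma ln_one_plus_quadratic_error:
  fixes u :: real
  assumes "\<bar>u\<bar> \<le> 1/2"
  shows "\<bar>ln (1 + u) - u + u\<^sup>2 / 2\<bar> \<le> 2 * \<bar>u\<bar>^3"
proof -
  define F where "F = (\<lambda>x::real. ln (1 + x) - x + x\<^sup>2 / 2)"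
  have der: "(F has_real_derivative x\<^sup>2 / (1 + x)) (at x within {-\<bar>u\<bar>..\<bar>u\<bar>})"
    if "x \<in> {-\<bar>u\<bar>..\<bar>u\<bar>}" for x
    unfolding F_def using that assms
    by (auto intro!: derivative_eq_intros simp: field_simps power2_eq_square)
  have bound: "norm (x\<^sup>2 / (1 + x)) \<le> 2 * u\<^sup>2" if "x \<in> {-\<bar>u\<bar>..\<bar>u\<bar>}" for x
  proof -
    have "x\<^sup>2 \<le> u\<^sup>2" using that by (auto simp: abs_le_square_iff[symmetric])
    moreover have "1/2 \<le> 1 + x" using that assms by auto
    ultimately have "x\<^sup>2 / (1 + x) \<le> u\<^sup>2 / (1/2)" by (intro frac_le) auto
    then show ?thesis using \<open>1/2 \<le> 1 + x\<close> by auto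
  qed
  have "norm (F u - F 0) \<le> 2 * u\<^sup>2 * norm (u - 0)"
    by (rule field_differentiable_bound[OF _ der bound]) auto
  then show ?thesis by (simp add: F_def power3_eq_cube power2_eq_square abs_mult mult.assoc)
qed

text \<open>The mass condition uses the nonnegative integral, so that it carries integrability with
  it. Nonnegativity holds everywhere, as for the fixed density versions in
  \<open>iid_family\<close>.\<close>

definition prob_density :: "(real \<Rightarrow> real) \<Rightarrow> bool" where
  "prob_density p \<longleftrightarrow> p \<in> borel_measurable borel \<and> (\<forall>x. 0 \<le> p x) \<and> (\<integral>\<^sup>+x. ennreal (p x) \<partial>lborel) = 1"

lemma prob_densityD:
  assumes "prob_density p"
  shows "p \<in> borel_measurable borel" "0 \<le> p x" "integrable lborel p" "(\<integral>x. p x \<partial>lborel) = 1"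
    "(\<integral>\<^sup>+x. ennreal (p x) \<partial>lborel) = 1"
  using assms unfolding prob_density_def
  by (auto intro!: integrableI_nonneg simp: integral_eq_nn_integral)

lemma prob_density_integrable_mult:
  assumes p: "prob_density p" and h: "h \<in> borel_measurable borel" "\<And>x. \<bar>h x\<bar> \<le> C"
  shows "integrable lborel (\<lambda>x. p x * h x :: real)"
proof (rule Bochner_Integration.integrable_bound)
  show "integrable lborel (\<lambda>x. C * p x)" using prob_densityD[OF p] by simp
  have "\<bar>p x * h x\<bar> \<le> \<bar>C * p x\<bar>" for x
    using h(2)[of x] prob_densityD(2)[OF p, of x]
    by (subst mult.commute) (simp only: abs_mult, intro mult_mono, auto)
  then show "AE x in lborel. norm (p x * h x) \<le> norm (C * p x)" by simp
qed (use p h in \<open>auto simp: prob_density_def\<close>)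

lemma prob_density_integral_mult_bound:
  assumes p: "prob_density p" and h: "h \<in> borel_measurable borel" "\<And>x. \<bar>h x\<bar> \<le> C"
  shows "\<bar>\<integral>x. p x * h x \<partial>lborel\<bar> \<le> (C :: real)"
proof -
  have "\<bar>p x * h x\<bar> \<le> p x * C" for x
    using h(2)[of x] prob_densityD(2)[OF p, of x] by (simp add: abs_mult mult_left_mono)
  then have "(\<integral>x. \<bar>p x * h x\<bar> \<partial>lborel) \<le> (\<integral>x. p x * C \<partial>lborel)"
    by (intro integral_mono integrable_abs prob_density_integrable_mult[OF p h]
        integrable_mult_left prob_densityD(3)[OF p])
  then have "\<bar>\<integral>x. p x * h x \<partial>lborel\<bar> \<le> (\<integral>x. p x * C \<partial>lborel)"
    by (rule order_trans[OF integral_abs_bound])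
  then show ?thesis using prob_densityD[OF p] by simp
qed

section \<open>Relative entropy as an extended integral\<close>

lemma KL_integrand_measurable:
  assumes [measurable]: "p \<in> borel_measurable borel" "q \<in> borel_measurable borel"
  shows "KL_integrand p q \<in> borel_measurable borel"
  unfolding KL_integrand_def[abs_def] by measurable

text \<open>Multiplying \<open>ln t <= t - 1\<close> at \<open>t = q / p\<close> by \<open>p\<close>
  bounds the negative part by \<open>q\<close>, which has mass 1. Hence \<open>KL\<close> never
  takes the form \<infinity> - \<infinity>.\<close>

lemma nn_integral_KL_integrand_neg_le:
  assumes p: "prob_density p" and q: "prob_density q"
  shows "(\<integral>\<^sup>+x. e2ennreal (- KL_integrand p q x) \<partial>lborel) \<le> 1"
proof -
  have "e2ennreal (- KL_integrand p q x) \<le> ennreal (q x)" for x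
  proof (cases "p x = 0 \<or> q x = 0")
    case True then show ?thesis by (auto simp: KL_integrand_def e2ennreal_neg zero_ereal_def[symmetric])
  next
    case False
    then have pos: "0 < p x" "0 < q x"
      using prob_densityD(2)[OF p, of x] prob_densityD(2)[OF q, of x] by auto
    have "ln (q x / p x) \<le> q x / p x - 1" using pos by (intro ln_le_minus_one) auto
    then have "ln (q x / p x) * p x \<le> (q x / p x - 1) * p x" using pos by (intro mult_right_mono) auto
    then have "- (ln (p x / q x) * p x) \<le> q x"
      using pos by (simp add: ln_div algebra_simps)
    then show ?thesis using False by (auto simp: KL_integrand_def ennreal.rep_eq e2ennreal_ereal intro!: ennreal_leI)
  qed
  then have "(\<integral>\<^sup>+x. e2ennreal (- KL_integrand p q x) \<partial>lborel) \<le> (\<integral>\<^sup>+x. ennreal (q x) \<partial>lborel)"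
    by (intro nn_integral_mono) auto
  then show ?thesis using prob_densityD(5)[OF q] by simp
qed

lemma integral_as_enn2ereal_diff:
  assumes "integrable M (g :: _ \<Rightarrow> real)"
  shows "enn2ereal (\<integral>\<^sup>+x. ennreal (g x) \<partial>M) - enn2ereal (\<integral>\<^sup>+x. ennreal (- g x) \<partial>M) = ereal (integral\<^sup>L M g)"
proof -
  have fin: "(\<integral>\<^sup>+x. ennreal (g x) \<partial>M) \<noteq> \<infinity>" "(\<integral>\<^sup>+x. ennreal (- g x) \<partial>M) \<noteq> \<infinity>"
    using assms by (auto simp: real_integrable_def)
  show ?thesis
    unfolding real_lebesgue_integral_def[OF assms]
    using fin by (cases "\<integral>\<^sup>+x. ennreal (g x) \<partial>M"; cases "\<integral>\<^sup>+x. ennreal (- g x) \<partial>M") 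
      (auto simp: enn2ereal_ennreal)
qed

text \<open>The negative part is always finite, so a finite \<open>KL\<close> makes the positive
  part finite too. The integrand is then finite almost everywhere, which rules out
  \<open>q = 0 < p\<close> off a null set and reduces \<open>KL\<close> to a Bochner
  integral.\<close>

lemma KL_eq_ereal_imp:
  assumes p: "prob_density p" and q: "prob_density q" and d: "KL p q = ereal d"
  shows "AE x in lborel. p x \<noteq> 0 \<longrightarrow> q x \<noteq> 0"
    and "integrable lborel (\<lambda>x. ln (p x / q x) * p x)"
    and "(\<integral>x. ln (p x / q x) * p x \<partial>lborel) = d"
proof -
  note [measurable] = prob_densityD(1)[OF p] prob_densityD(1)[OF q]
  have km[measurable]: "KL_integrand p q \<in> borel_measurable borel"
    by (rule KL_integrand_measurable) measurable
  let ?h = "\<lambda>x. ln (p x / q x) * p x"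
  let ?P = "\<integral>\<^sup>+x. e2ennreal (KL_integrand p q x) \<partial>lborel"
  let ?N = "\<integral>\<^sup>+x. e2ennreal (- KL_integrand p q x) \<partial>lborel"
  have N: "?N \<noteq> \<infinity>" using nn_integral_KL_integrand_neg_le[OF p q] by (auto simp: top_unique)
  have P: "?P \<noteq> \<infinity>"
  proof
    assume "?P = \<infinity>"
    moreover obtain r where "?N = ennreal r" "0 \<le> r" using N by (cases ?N) auto
    ultimately show False using d by (simp add: KL_def enn2ereal_ennreal)
  qed
  have "AE x in lborel. e2ennreal (KL_integrand p q x) \<noteq> \<infinity>"
    by (rule nn_integral_PInf_AE[OF _ P]) measurable
  then show ae: "AE x in lborel. p x \<noteq> 0 \<longrightarrow> q x \<noteq> 0"
    by eventually_elim (auto simp: KL_integrand_def split: if_splits)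
  have eq: "AE x in lborel. KL_integrand p q x = ereal (?h x)"
    using ae by eventually_elim (auto simp: KL_integrand_def)
  have P': "?P = (\<integral>\<^sup>+x. ennreal (?h x) \<partial>lborel)"
    by (rule nn_integral_cong_AE) (use eq in eventually_elim, simp add: e2ennreal_ereal)
  have N': "?N = (\<integral>\<^sup>+x. ennreal (- ?h x) \<partial>lborel)"
    by (rule nn_integral_cong_AE) (use eq in eventually_elim, simp add: e2ennreal_ereal)
  show int: "integrable lborel ?h"
    using P N unfolding real_integrable_def P' N' by simp
  show "(\<integral>x. ?h x \<partial>lborel) = d"
    using integral_as_enn2ereal_diff[OF int] d unfolding KL_def P' N' by simp
qed

section \<open>Duality and second-order expansion\<close>

text \<open>The Lagrange dual function of maximising \<open>E_q[\<phi>] - KL p q / e\<close> over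
  densities \<open>q\<close>, with multiplier \<open>l / e\<close> for the constraint that
  \<open>q\<close> has mass 1. The inner supremum is attained at
  \<open>q = p / (l - e * \<phi>)\<close>.\<close>

definition dual_value :: "(real \<Rightarrow> real) \<Rightarrow> (real \<Rightarrow> real) \<Rightarrow> real \<Rightarrow> real \<Rightarrow> real" where
  "dual_value p \<phi> e l = (l - 1 - (\<integral>x. p x * ln (l - e * \<phi> x) \<partial>lborel)) / e"

text \<open>The uniform lower bound \<open>c\<close> keeps the logarithm bounded below; mere
  pointwise positivity would not.\<close>

lemma integrable_mult_ln_affine:
  fixes B :: real
  assumes p: "prob_density p" and \<phi>[measurable]: "\<phi> \<in> borel_measurable borel"
    and B: "\<And>x. \<bar>\<phi> x\<bar> \<le> B" and c: "0 < c" "\<And>x. c \<le> l - e * \<phi> x"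
  shows "integrable lborel (\<lambda>x. p x * ln (l - e * \<phi> x))"
proof (rule prob_density_integrable_mult[OF p])
  define D where "D = \<bar>l\<bar> + \<bar>e\<bar> * B"
  fix x
  have "\<bar>e * \<phi> x\<bar> \<le> \<bar>e\<bar> * B" using B[of x] by (simp add: abs_mult mult_left_mono)
  then have D: "l - e * \<phi> x \<le> D" unfolding D_def by linarith
  have "ln c \<le> ln (l - e * \<phi> x)" "ln (l - e * \<phi> x) \<le> ln D"
    using c(2)[of x] c(1) D by auto
  then show "\<bar>ln (l - e * \<phi> x)\<bar> \<le> \<bar>ln c\<bar> + \<bar>ln D\<bar>" by linarith
qed measurable

lemma integral_mult_affine:
  fixes B :: real
  assumes q: "prob_density q" and \<phi>: "\<phi> \<in> borel_measurable borel"
    and B: "\<And>x. \<bar>\<phi> x\<bar> \<le> B"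
  shows "integrable lborel (\<lambda>x. q x * (l - e * \<phi> x))"
    and "(\<integral>x. q x * (l - e * \<phi> x) \<partial>lborel) = l - e * (\<integral>x. q x * \<phi> x \<partial>lborel)"
proof -
  note int = prob_densityD(3)[OF q] prob_density_integrable_mult[OF q \<phi> B]
  have eq: "q x * (l - e * \<phi> x) = q x * l - e * (q x * \<phi> x)" for x by (simp add: algebra_simps)
  show "integrable lborel (\<lambda>x. q x * (l - e * \<phi> x))" unfolding eq using int by simp
  show "(\<integral>x. q x * (l - e * \<phi> x) \<partial>lborel) = l - e * (\<integral>x. q x * \<phi> x \<partial>lborel)"
    unfolding eq using int prob_densityD(4)[OF q] by simp
qed

text \<open>With \<open>w = l - e * \<phi>\<close>, multiplying \<open>ln t <= t - 1\<close> at
  \<open>t = q * w / p\<close> by \<open>p\<close> puts \<open>q * w\<close> on the right, whose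
  integral is \<open>l - e * E_q[\<phi>]\<close>. The multiplier \<open>l\<close> stays free: two
  different choices are used later.\<close>

lemma expectation_minus_KL_le_dual_value:
  fixes B :: real
  assumes p: "prob_density p" and q: "prob_density q" and d: "KL p q = ereal d"
    and \<phi>[measurable]: "\<phi> \<in> borel_measurable borel" and B: "\<And>x. \<bar>\<phi> x\<bar> \<le> B"
    and c: "0 < c" "\<And>x. c \<le> l - e * \<phi> x" and e: "0 < e"
  shows "(\<integral>x. q x * \<phi> x \<partial>lborel) - d / e \<le> dual_value p \<phi> e l"
proof -
  note KL = KL_eq_ereal_imp[OF p q d]
  let ?w = "\<lambda>x. l - e * \<phi> x"
  have intr: "integrable lborel (\<lambda>x. q x * ?w x - p x - p x * ln (?w x))"
    using integral_mult_affine(1)[OF q \<phi> B, of l e] prob_densityD(3)[OF p]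
      integrable_mult_ln_affine[OF p \<phi> B c]
    by simp
  have "AE x in lborel. - (ln (p x / q x) * p x) \<le> q x * ?w x - p x - p x * ln (?w x)"
    using KL(1)
  proof eventually_elim
    case (elim x)
    have w: "0 < ?w x" using c(1) c(2)[of x] by linarith
    show ?case
    proof (cases "p x = 0")
      case True then show ?thesis using w prob_densityD(2)[OF q, of x] by simp
    next
      case False
      then have pos: "0 < p x" "0 < q x"
        using elim prob_densityD(2)[OF p, of x] prob_densityD(2)[OF q, of x] by auto
      have "ln (q x * ?w x / p x) \<le> q x * ?w x / p x - 1"
        using pos w by (intro ln_le_minus_one) auto
      then have "ln (q x * ?w x / p x) * p x \<le> (q x * ?w x / p x - 1) * p x"
        using pos by (intro mult_right_mono) auto
      also have "\<dots> = q x * ?w x - p x" using pos by (simp add: field_simps)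
      finally have "(ln (q x) + ln (?w x) - ln (p x)) * p x \<le> q x * ?w x - p x"
        using pos w by (simp add: ln_div ln_mult)
      moreover have ln_eq: "ln (p x / q x) = ln (p x) - ln (q x)" using pos by (simp add: ln_div)
      ultimately show ?thesis unfolding ln_eq by (simp add: algebra_simps)
    qed
  qed
  then have "(\<integral>x. - (ln (p x / q x) * p x) \<partial>lborel) \<le> (\<integral>x. q x * ?w x - p x - p x * ln (?w x) \<partial>lborel)"
    using KL(2) intr by (intro integral_mono_AE) auto
  then have "- d \<le> l - e * (\<integral>x. q x * \<phi> x \<partial>lborel) - 1 - (\<integral>x. p x * ln (?w x) \<partial>lborel)"
    using integral_mult_affine[OF q \<phi> B, of l e] prob_densityD(3,4)[OF p] KL(3)
      integrable_mult_ln_affine[OF p \<phi> B c]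
    by simp
  then have "(e * (\<integral>x. q x * \<phi> x \<partial>lborel) - d) / e \<le> dual_value p \<phi> e l"
    unfolding dual_value_def using e by (intro divide_right_mono) auto
  then show ?thesis using e by (simp add: diff_divide_distrib)
qed

text \<open>Integrate \<open>q * (l - e * \<phi>) = p\<close>. The identity closes the duality gap
  and also yields |l - 1| \<le> e * B, as the expansion requires.\<close>

lemma tilted_density_multiplier:
  fixes B :: real
  assumes p: "prob_density p" and q: "prob_density q"
    and \<phi>: "\<phi> \<in> borel_measurable borel" and B: "\<And>x. \<bar>\<phi> x\<bar> \<le> B"
    and c: "0 < c" "\<And>x. c \<le> l - e * \<phi> x"
    and tilt: "AE x in lborel. q x = p x / (l - e * \<phi> x)"
  shows "l - 1 = e * (\<integral>x. q x * \<phi> x \<partial>lborel)"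
proof -
  have "(\<integral>x. q x * (l - e * \<phi> x) \<partial>lborel) = (\<integral>x. p x \<partial>lborel)"
  proof (rule integral_cong_AE)
    show "AE x in lborel. q x * (l - e * \<phi> x) = p x"
      using tilt
    proof eventually_elim
      case (elim x)
      have "l - e * \<phi> x \<noteq> 0" using c(1) c(2)[of x] by linarith
      then show ?case using elim by simp
    qed
  qed (use integral_mult_affine(1)[OF q \<phi> B] prob_densityD(1)[OF p] in auto)
  then show ?thesis
    using integral_mult_affine(2)[OF q \<phi> B, of l e] prob_densityD(4)[OF p] by simp
qed

text \<open>Under the tilt \<open>p / q = l - e * \<phi>\<close> wherever \<open>p\<close> is
  nonzero, so \<open>KL p q\<close> is the integral of \<open>p * ln (l - e * \<phi>)\<close>; the
  remaining term \<open>l - 1\<close> is \<open>e * E_q[\<phi>]\<close>.\<close>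

lemma tilted_density_attains_dual_value:
  fixes B :: real
  assumes p: "prob_density p" and q: "prob_density q"
    and \<phi>[measurable]: "\<phi> \<in> borel_measurable borel" and B: "\<And>x. \<bar>\<phi> x\<bar> \<le> B"
    and c: "0 < c" "\<And>x. c \<le> l - e * \<phi> x" and e: "0 < e"
    and tilt: "AE x in lborel. q x = p x / (l - e * \<phi> x)"
  obtains d where "KL p q = ereal d" "(\<integral>x. q x * \<phi> x \<partial>lborel) - d / e = dual_value p \<phi> e l"
proof -
  let ?g = "\<lambda>x. p x * ln (l - e * \<phi> x)"
  have int: "integrable lborel ?g" by (rule integrable_mult_ln_affine[OF p \<phi> B c])
  have eq: "AE x in lborel. KL_integrand p q x = ereal (?g x)"
    using tilt
  proof eventually_elim
    case (elim x)
    have "l - e * \<phi> x \<noteq> 0" using c(1) c(2)[of x] by linarith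
    then show ?case using elim by (simp add: KL_integrand_def)
  qed
  have "(\<integral>\<^sup>+x. e2ennreal (KL_integrand p q x) \<partial>lborel) = (\<integral>\<^sup>+x. ennreal (?g x) \<partial>lborel)"
    by (rule nn_integral_cong_AE) (use eq in eventually_elim, simp)
  moreover have "(\<integral>\<^sup>+x. e2ennreal (- KL_integrand p q x) \<partial>lborel) = (\<integral>\<^sup>+x. ennreal (- ?g x) \<partial>lborel)"
    by (rule nn_integral_cong_AE) (use eq in eventually_elim, simp)
  ultimately have "KL p q = ereal (integral\<^sup>L lborel ?g)"
    unfolding KL_def by (simp add: integral_as_enn2ereal_diff[OF int])
  moreover have "(\<integral>x. q x * \<phi> x \<partial>lborel) - integral\<^sup>L lborel ?g / e = dual_value p \<phi> e l"
    using tilted_density_multiplier[OF p q \<phi> B c tilt] e by (simp add: dual_value_def field_simps)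
  ultimately show ?thesis by (rule that)
qed

text \<open>Write \<open>l - e * \<phi> = 1 + u\<close> with
  \<open>u = a - e * (\<phi> - m)\<close>. Under \<open>p\<close>, \<open>u\<close> has mean
  \<open>a\<close> and second moment \<open>a^2 + e^2 * V\<close>, which gives the main terms. The
  condition on \<open>e\<close> makes |u| \<le> 2 * e * B \<le> 1/2, so the logarithm error is at
  most \<open>2 * (2 * e * B)^3\<close>; division by \<open>e\<close> leaves
  \<open>16 * B^3 * e^2\<close>.\<close>

lemma dual_value_expansion:
  fixes B :: real
  assumes p: "prob_density p" and \<phi>[measurable]: "\<phi> \<in> borel_measurable borel"
    and B: "\<And>x. \<bar>\<phi> x\<bar> \<le> B" and e: "0 < e" "4 * e * B \<le> 1" and l: "\<bar>l - 1\<bar> \<le> e * B"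
  defines "m \<equiv> \<integral>x. p x * \<phi> x \<partial>lborel"
  defines "V \<equiv> \<integral>x. p x * (\<phi> x - m)\<^sup>2 \<partial>lborel"
  shows "\<bar>dual_value p \<phi> e l - (m + e / 2 * V + (l - 1 - e * m)\<^sup>2 / (2 * e))\<bar> \<le> 16 * B^3 * e\<^sup>2"
proof -
  define a where "a = l - 1 - e * m"
  define u where "u x = l - 1 - e * \<phi> x" for x
  define \<rho> where "\<rho> x = ln (1 + u x) - u x + (u x)\<^sup>2 / 2" for x
  have [measurable]: "u \<in> borel_measurable borel" "\<rho> \<in> borel_measurable borel"
    unfolding u_def[abs_def] \<rho>_def[abs_def] by measurable
  have u: "\<bar>u x\<bar> \<le> 2 * e * B" for x
  proof -
    have "\<bar>e * \<phi> x\<bar> \<le> e * B" using B[of x] e by (simp add: abs_mult)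
    then show ?thesis using l unfolding u_def by linarith
  qed
  have \<rho>: "\<bar>\<rho> x\<bar> \<le> 16 * e^3 * B^3" for x
  proof -
    have "\<bar>\<rho> x\<bar> \<le> 2 * \<bar>u x\<bar>^3"
      unfolding \<rho>_def using u[of x] e by (intro ln_one_plus_quadratic_error) linarith
    also have "\<dots> \<le> 2 * (2 * e * B)^3"
      using u[of x] by (intro mult_left_mono power_mono) auto
    finally show ?thesis by (simp add: power_mult_distrib)
  qed
  have int\<rho>: "integrable lborel (\<lambda>x. p x * \<rho> x)"
    by (rule prob_density_integrable_mult[OF p _ \<rho>]) measurable
  have int\<phi>: "integrable lborel (\<lambda>x. p x * \<phi> x)"
    by (rule prob_density_integrable_mult[OF p \<phi> B])
  have m: "\<bar>m\<bar> \<le> B" unfolding m_def by (rule prob_density_integral_mult_bound[OF p \<phi> B])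
  have intV: "integrable lborel (\<lambda>x. p x * (\<phi> x - m)\<^sup>2)"
  proof (rule prob_density_integrable_mult[OF p])
    have "\<bar>\<phi> x - m\<bar> \<le> \<bar>2 * B\<bar>" for x using B[of x] m by linarith
    then show "\<bar>(\<phi> x - m)\<^sup>2\<bar> \<le> (2 * B)\<^sup>2" for x
      unfolding abs_power2 by (simp only: abs_le_square_iff)
  qed measurable
  have intp: "integrable lborel p" by (rule prob_densityD(3)[OF p])
  \<comment> \<open>The integrand becomes a linear combination of four functions already known to be
    integrable, so that the integral can be taken term by term. The cross term in
    \<open>\<phi> - m\<close> is split accordingly.\<close>
  have expand: "p x * ln (l - e * \<phi> x) =
      (l - 1) * p x - e * (p x * \<phi> x) -
        (a\<^sup>2 + 2 * a * e * m) / 2 * p x + a * e * (p x * \<phi> x) - e\<^sup>2 / 2 * (p x * (\<phi> x - m)\<^sup>2) + p x * \<rho> x"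
    for x
  proof -
    have u_eq: "u x = a - e * (\<phi> x - m)" by (simp add: u_def a_def algebra_simps)
    have "ln (l - e * \<phi> x) = u x - (u x)\<^sup>2 / 2 + \<rho> x" by (simp add: \<rho>_def u_def)
    also have "(u x)\<^sup>2 = a\<^sup>2 + 2 * a * e * m - 2 * a * e * \<phi> x + e\<^sup>2 * (\<phi> x - m)\<^sup>2"
      unfolding u_eq by (simp add: power2_eq_square algebra_simps)
    finally have "ln (l - e * \<phi> x) = (l - 1 - e * \<phi> x)
        - (a\<^sup>2 + 2 * a * e * m - 2 * a * e * \<phi> x + e\<^sup>2 * (\<phi> x - m)\<^sup>2) / 2 + \<rho> x"
      by (simp add: u_def)
    then show ?thesis by (simp only:) (simp add: field_simps)
  qed
  have int_ln: "(\<integral>x. p x * ln (l - e * \<phi> x) \<partial>lborel) =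
      (l - 1) - e * m - (a\<^sup>2 + 2 * a * e * m) / 2 + a * e * m - e\<^sup>2 / 2 * V + (\<integral>x. p x * \<rho> x \<partial>lborel)"
    unfolding expand V_def using int\<rho> int\<phi> intV intp prob_densityD(4)[OF p] by (simp add: m_def)
  have "dual_value p \<phi> e l - (m + e / 2 * V + a\<^sup>2 / (2 * e)) = - (\<integral>x. p x * \<rho> x \<partial>lborel) / e"
    unfolding dual_value_def int_ln using e(1) by (simp add: field_simps power2_eq_square)
  then have "\<bar>dual_value p \<phi> e l - (m + e / 2 * V + a\<^sup>2 / (2 * e))\<bar> = \<bar>\<integral>x. p x * \<rho> x \<partial>lborel\<bar> / e"
    using e(1) by simp
  also have "\<dots> \<le> 16 * e^3 * B^3 / e"
    using e(1) by (intro divide_right_mono prob_density_integral_mult_bound[OF p _ \<rho>]) auto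
  also have "\<dots> = 16 * B^3 * e\<^sup>2" using e(1) by (simp add: power2_eq_square power3_eq_cube)
  finally show ?thesis by (simp only: a_def)
qed

text \<open>Weak duality at \<open>l = 1 + e * m\<close>, the multiplier for which the square in the
  expansion vanishes.\<close>

lemma expectation_le_mean_plus_KL:
  fixes B :: real
  assumes p: "prob_density p" and q: "prob_density q" and d: "KL p q = ereal d"
    and \<phi>: "\<phi> \<in> borel_measurable borel" and B: "\<And>x. \<bar>\<phi> x\<bar> \<le> B"
    and e: "0 < e" "4 * e * B \<le> 1"
  defines "m \<equiv> \<integral>x. p x * \<phi> x \<partial>lborel"
  defines "V \<equiv> \<integral>x. p x * (\<phi> x - m)\<^sup>2 \<partial>lborel"
  shows "(\<integral>x. q x * \<phi> x \<partial>lborel) \<le> m + d / e + (e / 2 * V + 16 * B^3 * e\<^sup>2)"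
proof -
  have m: "\<bar>e * m\<bar> \<le> e * B"
    unfolding m_def using prob_density_integral_mult_bound[OF p \<phi> B] e by (simp add: abs_mult)
  have "\<bar>e * \<phi> x\<bar> \<le> e * B" for x using B[of x] e by (simp add: abs_mult)
  \<comment> \<open>The terms \<open>e * m\<close> and \<open>e * \<phi> x\<close> differ by at most
    \<open>2 * e * B\<close>, hence by at most 1/2.\<close>
  then have c: "1 / 2 \<le> 1 + e * m - e * \<phi> x" for x
    using m e(2) abs_le_D1[of "e * \<phi> x" "e * B"] abs_le_D2[of "e * m" "e * B"] by fastforce
  have "(\<integral>x. q x * \<phi> x \<partial>lborel) - d / e \<le> dual_value p \<phi> e (1 + e * m)"
    by (rule expectation_minus_KL_le_dual_value[OF p q d \<phi> B _ c e(1)]) auto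
  moreover have "dual_value p \<phi> e (1 + e * m) \<le> m + e / 2 * V + 16 * B^3 * e\<^sup>2"
    using dual_value_expansion[OF p \<phi> B e, of "1 + e * m"] m unfolding m_def V_def by simp
  ultimately show ?thesis by simp
qed

section \<open>Divergence and DR-expectation for one fixed sample\<close>

text \<open>A real bound admits only equal values or two finite ones. This is how finiteness passes
  between the divergence and the relative entropy.\<close>

lemma ext_dist_le_ereal_iff:
  "ext_dist a b \<le> ereal u \<longleftrightarrow>
    (a = b \<and> 0 \<le> u) \<or> (\<exists>r s. a = ereal r \<and> b = ereal s \<and> \<bar>r - s\<bar> \<le> u)"
  by (cases a; cases b) (auto simp: ext_dist_def zero_ereal_def)

lemma likelihood_nonneg: "(\<And>x. 0 \<le> f Q x) \<Longrightarrow> 0 \<le> likelihood f N x Q"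
  by (simp add: likelihood_def prod_nonneg)

text \<open>The value \<open>-\<infinity>\<close> at likelihood 0 keeps the logarithm monotone, so a
  maximiser of the likelihood also attains the supremum of the logarithms.\<close>

lemma SUP_log_likelihood_eq:
  assumes nn: "\<And>Q y. Q \<in> \<Q> \<Longrightarrow> 0 \<le> f Q y" and Qh: "Qh \<in> \<Q>"
    and max: "\<And>Q. Q \<in> \<Q> \<Longrightarrow> likelihood f N x Q \<le> likelihood f N x Qh"
  shows "(SUP Q\<in>\<Q>. log_likelihood f N x Q) = log_likelihood f N x Qh"
proof (rule antisym[OF SUP_least SUP_upper[OF Qh]])
  fix Q assume Q: "Q \<in> \<Q>"
  have "0 \<le> likelihood f N x Q" "0 \<le> likelihood f N x Qh"
    using likelihood_nonneg nn Q Qh by metis+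
  then show "log_likelihood f N x Q \<le> log_likelihood f N x Qh"
    using max[OF Q] by (auto simp: log_likelihood_def)
qed

lemma divergence_nonneg:
  assumes nn: "\<And>Q y. Q \<in> \<Q> \<Longrightarrow> 0 \<le> f Q y" and Qh: "Qh \<in> \<Q>"
    and max: "\<And>Q. Q \<in> \<Q> \<Longrightarrow> likelihood f N x Q \<le> likelihood f N x Qh"
    and Q: "Q \<in> \<Q>"
  shows "0 \<le> divergence \<Q> f N x Q"
proof -
  have S: "(SUP Q\<in>\<Q>. log_likelihood f N x Q) = log_likelihood f N x Qh"
    using nn Qh max by (rule SUP_log_likelihood_eq)
  have "log_likelihood f N x Q \<le> log_likelihood f N x Qh"
    using SUP_upper[OF Q] unfolding S[symmetric] .
  \<comment> \<open>If both likelihoods vanish, the sum is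
    \<open>\<infinity> + -\<infinity>\<close>, which is \<open>\<infinity>\<close> in
    \<open>ereal\<close>; nonnegativity survives.\<close>
  then show ?thesis
    unfolding divergence_def S by (auto simp: log_likelihood_def)
qed

lemma divergence_finite:
  assumes nn: "\<And>Q y. Q \<in> \<Q> \<Longrightarrow> 0 \<le> f Q y" and Qh: "Qh \<in> \<Q>"
    and max: "\<And>Q. Q \<in> \<Q> \<Longrightarrow> likelihood f N x Q \<le> likelihood f N x Qh"
    and Q: "Q \<in> \<Q>" and pos: "likelihood f N x Q \<noteq> 0"
  obtains a where "divergence \<Q> f N x Q = ereal a"
proof -
  have S: "(SUP Q\<in>\<Q>. log_likelihood f N x Q) = log_likelihood f N x Qh"
    using nn Qh max by (rule SUP_log_likelihood_eq)
  have "likelihood f N x Qh \<noteq> 0"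
    using max[OF Q] pos likelihood_nonneg[of f Q N x, OF nn[OF Q]] by linarith
  with pos show ?thesis
    by (intro that) (unfold divergence_def S, simp add: log_likelihood_def)
qed

text \<open>One finite divergence certifies that some likelihood is positive. If all likelihoods
  vanished, every divergence would be infinite, including that of the maximiser.\<close>

lemma divergence_maximizer_eq_0:
  assumes nn: "\<And>Q y. Q \<in> \<Q> \<Longrightarrow> 0 \<le> f Q y" and Qh: "Qh \<in> \<Q>"
    and max: "\<And>Q. Q \<in> \<Q> \<Longrightarrow> likelihood f N x Q \<le> likelihood f N x Qh"
    and Q: "Q \<in> \<Q>" and fin: "divergence \<Q> f N x Q = ereal a"
  shows "divergence \<Q> f N x Qh = 0"
proof -
  have S: "(SUP Q\<in>\<Q>. log_likelihood f N x Q) = log_likelihood f N x Qh"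
    using nn Qh max by (rule SUP_log_likelihood_eq)
  have "likelihood f N x Q \<noteq> 0" using fin by (auto simp: divergence_def log_likelihood_def)
  then have "likelihood f N x Qh \<noteq> 0"
    using max[OF Q] likelihood_nonneg[of f Q N x, OF nn[OF Q]] by linarith
  then show ?thesis
    unfolding divergence_def S by (simp add: log_likelihood_def zero_ereal_def)
qed

text \<open>An infinite divergence contributes \<open>-\<infinity>\<close> to the supremum, and
  nonnegativity excludes divergence \<open>-\<infinity>\<close>, so only finite values remain to be
  checked.\<close>

lemma dr_expectation_le:
  assumes k: "0 < k" and nn: "\<And>Q. Q \<in> \<Q> \<Longrightarrow> 0 \<le> divergence \<Q> f N x Q"
    and le: "\<And>Q a. Q \<in> \<Q> \<Longrightarrow> divergence \<Q> f N x Q = ereal a \<Longrightarrow>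
      prob_space.expectation Q \<xi> - a / k \<le> c"
  shows "dr_expectation \<Q> f N x k \<xi> \<le> ereal c"
  unfolding dr_expectation_def
proof (rule SUP_least)
  fix Q assume Q: "Q \<in> \<Q>"
  show "ereal (prob_space.expectation Q \<xi>) - ereal (1 / k) * divergence \<Q> f N x Q \<le> ereal c"
    using le[OF Q] nn[OF Q] k by (cases "divergence \<Q> f N x Q") auto
qed

lemma dr_expectation_ge:
  assumes "Q \<in> \<Q>" "divergence \<Q> f N x Q = ereal a"
  shows "ereal (prob_space.expectation Q \<xi> - a / k) \<le> dr_expectation \<Q> f N x k \<xi>"
  unfolding dr_expectation_def by (rule SUP_upper2[OF assms(1)]) (simp add: assms(2))

section \<open>Stochastic orders\<close>

text \<open>For fixed \<open>C\<close> the threshold \<open>C * N powr (-1/2)\<close> eventually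
  drops below \<open>\<delta>\<close>, so the limsup in question is below the limsup for every
  \<open>C\<close>, and the latter tends to 0 as \<open>C\<close> grows.\<close>

lemma bigO_P_imp_tendsto_0:
  assumes U: "bigO_P P U (\<lambda>N. real N powr (-1/2))" and \<delta>: "0 < \<delta>"
  shows "(\<lambda>N. outer_measure_of P {\<omega>\<in>space P. U N \<omega> > ereal \<delta>}) \<longlonglongrightarrow> 0"
proof -
  let ?F = "\<lambda>C::real. limsup (\<lambda>N. outer_measure_of P
    {\<omega>\<in>space P. \<bar>U N \<omega> / ereal (real N powr (-1/2))\<bar> > ereal C})"
  let ?L = "limsup (\<lambda>N. outer_measure_of P {\<omega>\<in>space P. U N \<omega> > ereal \<delta>})"
  have "?L \<le> ?F C" for C
  proof (rule Limsup_mono)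
    have "(\<lambda>N. C * real N powr (-1/2)) \<longlonglongrightarrow> C * 0"
      by (intro tendsto_mult_left tendsto_neg_powr filterlim_real_sequentially) auto
    then have "\<forall>\<^sub>F N in sequentially. C * real N powr (-1/2) < \<delta>"
      using \<delta> by (intro order_tendstoD) auto
    moreover have "\<forall>\<^sub>F N in sequentially. (1::nat) \<le> N" by (rule eventually_ge_at_top)
    ultimately show "\<forall>\<^sub>F N in sequentially. outer_measure_of P {\<omega>\<in>space P. U N \<omega> > ereal \<delta>}
      \<le> outer_measure_of P {\<omega>\<in>space P. \<bar>U N \<omega> / ereal (real N powr (-1/2))\<bar> > ereal C}"
    proof eventually_elim
      case (elim N)
      define s where "s = real N powr (-1/2)"
      have s: "0 < s" "C * s < \<delta>" using elim by (auto simp: s_def)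
      have "ereal C < \<bar>y / ereal s\<bar>" if "ereal \<delta> < y" for y
      proof (cases y)
        case (real r)
        then have "C < r / s" using that s by (auto simp: field_simps)
        then have "C < \<bar>r / s\<bar>" by linarith
        then show ?thesis using real s by simp
      qed (use that s in auto)
      then show ?case unfolding s_def by (intro outer_measure_of_mono) auto
    qed
  qed
  then have "\<forall>\<^sub>F C in at_top. ?L \<le> ?F C" by (rule always_eventually[OF allI])
  then have "?L \<le> 0"
    by (rule tendsto_lowerbound[OF U[unfolded bigO_P_def] _ trivial_limit_at_top_linorder])
  then show ?thesis by (intro tendsto_0_if_Limsup_eq_0_ennreal) simp
qed

text \<open>Since \<open>N / k * N powr (-1/2) = sqrt N / k\<close>, the same \<open>C\<close>
  serves for \<open>U\<close> and \<open>R\<close>; the inclusion of events is proved through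
  complements. Quantifying over real \<open>u\<close> above \<open>U\<close> makes the hypothesis
  vacuous on samples where \<open>U\<close> is \<open>\<infinity>\<close>.\<close>

lemma bigO_P_dominated:
  fixes R :: "nat \<Rightarrow> 'a \<Rightarrow> real"
  assumes U: "bigO_P P U (\<lambda>N. real N powr (-1/2))" and k: "\<And>N. N \<ge> 1 \<Longrightarrow> k N > 0"
    and R: "\<forall>\<^sub>F N in sequentially. \<forall>\<omega>\<in>space P. \<forall>u. U N \<omega> \<le> ereal u \<longrightarrow> \<bar>R N \<omega>\<bar> \<le> real N / k N * u"
  shows "bigO_P P (\<lambda>N \<omega>. ereal (R N \<omega>)) (\<lambda>N. sqrt (real N) / k N)"
  unfolding bigO_P_def
proof (rule tendsto_sandwich[OF _ _ tendsto_const U[unfolded bigO_P_def]])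
  show "\<forall>\<^sub>F C in at_top. limsup (\<lambda>N. outer_measure_of P
          {\<omega>\<in>space P. \<bar>ereal (R N \<omega>) / ereal (sqrt (real N) / k N)\<bar> > ereal C})
      \<le> limsup (\<lambda>N. outer_measure_of P {\<omega>\<in>space P. \<bar>U N \<omega> / ereal (real N powr (-1/2))\<bar> > ereal C})"
  proof (rule always_eventually, rule allI, rule Limsup_mono)
    fix C :: real
    show "\<forall>\<^sub>F N in sequentially. outer_measure_of P
          {\<omega>\<in>space P. \<bar>ereal (R N \<omega>) / ereal (sqrt (real N) / k N)\<bar> > ereal C}
      \<le> outer_measure_of P {\<omega>\<in>space P. \<bar>U N \<omega> / ereal (real N powr (-1/2))\<bar> > ereal C}"
      using R eventually_ge_at_top[of 1]
    proof eventually_elim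
      case (elim N)
      define s where "s = real N powr (-1/2)"
      have s: "0 < s" using elim by (auto simp: s_def)
      have "real N * s = sqrt (real N)"
        using elim by (simp add: s_def powr_minus_divide powr_half_sqrt real_div_sqrt)
      then have Ns: "real N / k N * (C * s) = C * (sqrt (real N) / k N)" by (simp add: field_simps)
      have pos: "0 < sqrt (real N) / k N" using elim k[of N] by simp
      have "\<bar>ereal (R N \<omega>) / ereal (sqrt (real N) / k N)\<bar> \<le> ereal C"
        if \<omega>: "\<omega> \<in> space P" and le: "\<bar>U N \<omega> / ereal s\<bar> \<le> ereal C" for \<omega>
      proof -
        have "U N \<omega> \<le> ereal (C * s)"
          using le s by (cases "U N \<omega>") (auto simp: field_simps)
        then have "\<bar>R N \<omega>\<bar> \<le> C * (sqrt (real N) / k N)" using elim \<omega> unfolding Ns[symmetric] by blast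
        then have "\<bar>R N \<omega>\<bar> / (sqrt (real N) / k N) \<le> C"
          using pos by (simp only: pos_divide_le_eq)
        moreover have "\<bar>ereal r / ereal t\<bar> = ereal (\<bar>r\<bar> / t)" if "0 < t" for r t :: real
          using that by simp
        ultimately show ?thesis using pos by (simp only: ereal_less_eq)
      qed
      then show ?case unfolding s_def not_le[symmetric] by (intro outer_measure_of_mono) blast
    qed
  qed
qed (rule always_eventually, rule allI, rule zero_le)

section \<open>Densities and likelihoods in the iid family\<close>

lemma iid_family_prob_density:
  assumes fam: "iid_family M \<Q> X Xs f" and Q: "Q \<in> \<Q>"
  shows "prob_density (f Q)"
proof -
  interpret prob_space Q using fam Q by (auto simp: iid_family_def)
  have f: "f Q \<in> borel_measurable borel" "\<And>x. 0 \<le> f Q x" "distributed Q lborel X (\<lambda>x. ennreal (f Q x))"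
    using fam Q by (auto simp: iid_family_def)
  have "(\<integral>\<^sup>+x. ennreal (f Q x) \<partial>lborel) = 1"
    using distributed_nn_integral[OF f(3), of "\<lambda>_. 1"] emeasure_space_1 by simp
  with f show ?thesis by (simp add: prob_density_def)
qed

lemma iid_family_expectation:
  assumes fam: "iid_family M \<Q> X Xs f" and Q: "Q \<in> \<Q>" and h: "h \<in> borel_measurable borel"
  shows "prob_space.expectation Q (\<lambda>\<omega>. h (X \<omega>)) = (\<integral>x. f Q x * h x \<partial>lborel)"
proof -
  have "distributed Q lborel X (\<lambda>x. ennreal (f Q x))" "\<And>x. 0 \<le> f Q x"
    using fam Q by (auto simp: iid_family_def)
  then show ?thesis using h by (subst distributed_integral[of Q lborel X "f Q"]) auto
qed

text \<open>The law of each observation has density \<open>f Q\<close> and so gives no mass to the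
  zero set of \<open>f Q\<close>. This later makes the divergence of the true measure almost surely
  finite.\<close>

lemma iid_family_AE_likelihood:
  assumes fam: "iid_family M \<Q> X Xs f" and Q: "Q \<in> \<Q>"
  shows "AE \<omega> in Q. likelihood f N (sample Xs N \<omega>) Q \<noteq> 0"
proof -
  have "AE \<omega> in Q. f Q (Xs n \<omega>) \<noteq> 0" if "n \<in> {1..N}" for n
  proof -
    have D: "distributed Q lborel (Xs n) (\<lambda>x. ennreal (f Q x))"
      and [measurable]: "f Q \<in> borel_measurable borel" and nn: "\<And>x. 0 \<le> f Q x"
      using fam Q that by (auto simp: iid_family_def)
    have "AE x in density lborel (\<lambda>x. ennreal (f Q x)). f Q x \<noteq> 0"
      by (subst AE_density) auto
    then have "AE x in distr Q lborel (Xs n). f Q x \<noteq> 0"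
      by (subst distributed_distr_eq_density[OF D])
    then show ?thesis
      using distributed_measurable[OF D] by (subst (asm) AE_distr_iff) auto
  qed
  then have "AE \<omega> in Q. \<forall>n\<in>{1..N}. f Q (Xs n \<omega>) \<noteq> 0" by (intro AE_finite_allI) auto
  then show ?thesis
    by eventually_elim (simp add: likelihood_def sample_def)
qed

section \<open>The dual value at the normalising multiplier\<close>

text \<open>The square \<open>(l - 1 - e * m)^2\<close> never has to be estimated. For the lower
  bound it is nonnegative; for the upper bound the dual value is the objective attained at
  \<open>q\<close>, which weak duality bounds through the other multiplier
  \<open>1 + e * m\<close>.\<close>

lemma tilted_dual_value_expansion:
  fixes B :: real
  assumes p: "prob_density p" and q: "prob_density q"
    and \<phi>: "\<phi> \<in> borel_measurable borel" and B: "\<And>x. \<bar>\<phi> x\<bar> \<le> B"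
    and c: "0 < c" "\<And>x. c \<le> l - e * \<phi> x" and e: "0 < e" "4 * e * B \<le> 1"
    and tilt: "AE x in lborel. q x = p x / (l - e * \<phi> x)"
  defines "m \<equiv> \<integral>x. p x * \<phi> x \<partial>lborel"
  defines "V \<equiv> \<integral>x. p x * (\<phi> x - m)\<^sup>2 \<partial>lborel"
  shows "\<bar>dual_value p \<phi> e l - (m + e / 2 * V)\<bar> \<le> 16 * B^3 * e\<^sup>2"
proof -
  obtain d where d: "KL p q = ereal d" "(\<integral>x. q x * \<phi> x \<partial>lborel) - d / e = dual_value p \<phi> e l"
    by (rule tilted_density_attains_dual_value[OF p q \<phi> B c e(1) tilt])
  have upper: "dual_value p \<phi> e l \<le> m + e / 2 * V + 16 * B^3 * e\<^sup>2"
    using expectation_le_mean_plus_KL[OF p q d(1) \<phi> B e] unfolding d(2)[symmetric] m_def V_def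
    by simp
  have "\<bar>l - 1\<bar> \<le> e * B"
    using prob_density_integral_mult_bound[OF q \<phi> B] e(1)
    unfolding tilted_density_multiplier[OF p q \<phi> B c tilt] by (simp add: abs_mult)
  then have "\<bar>dual_value p \<phi> e l - (m + e / 2 * V + (l - 1 - e * m)\<^sup>2 / (2 * e))\<bar> \<le> 16 * B^3 * e\<^sup>2"
    using dual_value_expansion[OF p \<phi> B e] unfolding m_def V_def by blast
  moreover have "0 \<le> (l - 1 - e * m)\<^sup>2 / (2 * e)" using e(1) by simp
  ultimately show ?thesis using upper by linarith
qed

lemma KL_refl: "KL p p = ereal 0"
proof -
  have "KL_integrand p p x = 0" for x by (simp add: KL_integrand_def)
  then show ?thesis by (simp add: KL_def zero_ereal_def[symmetric] e2ennreal_neg)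
qed

section \<open>Pathwise bounds on the DR-expectation\<close>

locale bounded_mle_family =
  fixes M :: "'a measure" and \<Q> :: "'a measure set" and X :: "'a \<Rightarrow> real"
    and Xs :: "nat \<Rightarrow> 'a \<Rightarrow> real" and f :: "'a measure \<Rightarrow> real \<Rightarrow> real"
    and \<phi> :: "real \<Rightarrow> real" and B :: real
  assumes family: "iid_family M \<Q> X Xs f" and mle: "mle_exists M \<Q> Xs f"
    and \<phi>: "\<phi> \<in> borel_measurable borel" and B: "\<And>x. \<bar>\<phi> x\<bar> \<le> B"
begin

abbreviation alpha :: "nat \<Rightarrow> 'a \<Rightarrow> 'a measure \<Rightarrow> ereal" where
  "alpha N \<omega> Q \<equiv> divergence \<Q> f N (sample Xs N \<omega>) Q"

abbreviation dr :: "nat \<Rightarrow> 'a \<Rightarrow> real \<Rightarrow> ereal" where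
  "dr N \<omega> \<kappa> \<equiv> dr_expectation \<Q> f N (sample Xs N \<omega>) \<kappa> (\<lambda>\<omega>. \<phi> (X \<omega>))"

text \<open>An integral over the line rather than an expectation under \<open>Q\<close>, so that the
  density lemmas apply directly; \<open>expectation_eq_mean\<close> and
  \<open>variance_eq_var\<close> translate back.\<close>

definition mean :: "'a measure \<Rightarrow> real" where
  "mean Q = (\<integral>x. f Q x * \<phi> x \<partial>lborel)"

definition var :: "'a measure \<Rightarrow> real" where
  "var Q = (\<integral>x. f Q x * (\<phi> x - mean Q)\<^sup>2 \<partial>lborel)"

text \<open>The deterministic content of the GCD bound on one sample. The expansion and closeness
  estimates for \<open>dr\<close> are derived pathwise from it; probability enters only through the
  size of \<open>u\<close>.\<close>

definition approx :: "nat \<Rightarrow> 'a \<Rightarrow> 'a measure \<Rightarrow> real \<Rightarrow> bool" where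
  "approx N \<omega> P u \<longleftrightarrow> (\<forall>Q\<in>\<Q>. ext_dist (alpha N \<omega> Q / ereal (real N)) (KL (f P) (f Q)) \<le> ereal u)"

lemma density: "Q \<in> \<Q> \<Longrightarrow> prob_density (f Q)"
  by (rule iid_family_prob_density[OF family])

lemma density_nonneg: "Q \<in> \<Q> \<Longrightarrow> 0 \<le> f Q y"
  using family by (simp add: iid_family_def)

lemma space_eq: "Q \<in> \<Q> \<Longrightarrow> space Q = space M"
  using family by (intro sets_eq_imp_space_eq) (auto simp: iid_family_def)

lemma expectation_eq_mean: "Q \<in> \<Q> \<Longrightarrow> prob_space.expectation Q (\<lambda>\<omega>. \<phi> (X \<omega>)) = mean Q"
  unfolding mean_def by (rule iid_family_expectation[OF family _ \<phi>])

lemma variance_eq_var: "Q \<in> \<Q> \<Longrightarrow> prob_space.expectation Q (\<lambda>\<omega>. (\<phi> (X \<omega>) - mean Q)\<^sup>2) = var Q"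
  unfolding var_def
  by (rule iid_family_expectation[OF family, where h = "\<lambda>x. (\<phi> x - mean _)\<^sup>2"])
     (use \<phi> in measurable)

lemma mean_le: "Q \<in> \<Q> \<Longrightarrow> \<bar>mean Q\<bar> \<le> B"
  unfolding mean_def by (rule prob_density_integral_mult_bound[OF density \<phi> B])

lemma maximizer:
  assumes "\<omega> \<in> space M" "N \<ge> 1"
  obtains Qh where "Qh \<in> \<Q>"
    "\<And>Q. Q \<in> \<Q> \<Longrightarrow> likelihood f N (sample Xs N \<omega>) Q \<le> likelihood f N (sample Xs N \<omega>) Qh"
proof -
  obtain Qhat where Qhat: "Qhat \<in> measurable (\<Pi>\<^sub>M n\<in>{1..N}. borel) (restrict_space (prob_algebra M) \<Q>)"
    and max: "\<forall>\<omega>\<in>space M. \<forall>Q\<in>\<Q>. likelihood f N (sample Xs N \<omega>) Q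
            \<le> likelihood f N (sample Xs N \<omega>) (Qhat (sample Xs N \<omega>))"
    using mle assms(2) unfolding mle_exists_def by blast
  have "sample Xs N \<omega> \<in> space (\<Pi>\<^sub>M n\<in>{1..N}. (borel :: real measure))"
    by (auto simp: space_PiM sample_def)
  \<comment> \<open>Membership in \<open>\<Q>\<close> is read off from the codomain of the
    measurable map.\<close>
  then have "Qhat (sample Xs N \<omega>) \<in> \<Q>"
    using measurable_space[OF Qhat] by (auto simp: space_restrict_space)
  then show ?thesis using that max assms(1) by blast
qed

lemma alpha_nonneg: "\<omega> \<in> space M \<Longrightarrow> N \<ge> 1 \<Longrightarrow> Q \<in> \<Q> \<Longrightarrow> 0 \<le> alpha N \<omega> Q"
  using maximizer divergence_nonneg[of \<Q> f, OF density_nonneg] by metis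

lemma approx_alphaD:
  assumes "approx N \<omega> P u" "Q \<in> \<Q>" "alpha N \<omega> Q = ereal a" "N \<ge> 1"
  obtains d where "KL (f P) (f Q) = ereal d" "\<bar>a / real N - d\<bar> \<le> u"
proof -
  have "ext_dist (ereal (a / real N)) (KL (f P) (f Q)) \<le> ereal u"
    using assms unfolding approx_def by force
  then show ?thesis using that
    by (cases "KL (f P) (f Q)") (auto simp: ext_dist_le_ereal_iff)
qed

lemma approx_KLD:
  assumes "approx N \<omega> P u" "Q \<in> \<Q>" "KL (f P) (f Q) = ereal d" "N \<ge> 1"
  obtains a where "alpha N \<omega> Q = ereal a" "\<bar>a / real N - d\<bar> \<le> u"
proof -
  have le: "ext_dist (alpha N \<omega> Q / ereal (real N)) (ereal d) \<le> ereal u"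
    using assms unfolding approx_def by force
  show ?thesis
  proof (cases "alpha N \<omega> Q")
    case (real a) then show ?thesis using le assms(4) that by (auto simp: ext_dist_le_ereal_iff)
  qed (use le assms(4) in \<open>auto simp: ext_dist_le_ereal_iff\<close>)
qed

lemma approx_nonneg:
  assumes "approx N \<omega> P u" "P \<in> \<Q>"
  shows "0 \<le> u"
proof -
  have "ext_dist (alpha N \<omega> P / ereal (real N)) (KL (f P) (f P)) \<le> ereal u"
    using assms unfolding approx_def by blast
  then show ?thesis by (auto simp: ext_dist_le_ereal_iff)
qed

text \<open>A nonnegative penalty only lowers the mean, so \<open>dr\<close> is never
  \<open>\<infinity>\<close>, whatever the sample.\<close>

lemma dr_le_bound:
  assumes \<omega>: "\<omega> \<in> space M" and N: "N \<ge> 1" and \<kappa>: "0 < \<kappa>"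
  shows "dr N \<omega> \<kappa> \<le> ereal B"
proof (rule dr_expectation_le[OF \<kappa> alpha_nonneg[OF \<omega> N]])
  fix Q a assume Q: "Q \<in> \<Q>" and a: "alpha N \<omega> Q = ereal a"
  have "0 \<le> a" using alpha_nonneg[OF \<omega> N Q] a by simp
  then have "0 \<le> a / \<kappa>" using \<kappa> by simp
  then show "prob_space.expectation Q (\<lambda>\<omega>. \<phi> (X \<omega>)) - a / \<kappa> \<le> B"
    using mean_le[OF Q] unfolding expectation_eq_mean[OF Q] by linarith
qed

lemma dr_ge:
  assumes "Q \<in> \<Q>" "alpha N \<omega> Q = ereal a"
  shows "ereal (mean Q - a / \<kappa>) \<le> dr N \<omega> \<kappa>"
  using dr_expectation_ge[of Q \<Q> f N "sample Xs N \<omega>" a "\<lambda>\<omega>. \<phi> (X \<omega>)" \<kappa>] assms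
  by (simp add: expectation_eq_mean)

text \<open>The candidate \<open>P\<close> gives a finite lower bound as soon as its own likelihood
  is nonzero.\<close>

lemma AE_dr_finite:
  assumes P: "P \<in> \<Q>" and N: "N \<ge> 1" and \<kappa>: "0 < \<kappa>"
  shows "AE \<omega> in P. dr N \<omega> \<kappa> = ereal (real_of_ereal (dr N \<omega> \<kappa>))"
  using iid_family_AE_likelihood[OF family P, of N] AE_space
proof eventually_elim
  case (elim \<omega>)
  then have \<omega>: "\<omega> \<in> space M" using space_eq[OF P] by simp
  obtain Qh where Qh: "Qh \<in> \<Q>"
    "\<And>Q. Q \<in> \<Q> \<Longrightarrow> likelihood f N (sample Xs N \<omega>) Q \<le> likelihood f N (sample Xs N \<omega>) Qh"
    using maximizer[OF \<omega> N] by blast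
  obtain a where "alpha N \<omega> P = ereal a"
    using divergence_finite[of \<Q> f Qh N "sample Xs N \<omega>" P] density_nonneg Qh P elim(1) by blast
  from dr_ge[OF P this, of \<kappa>] dr_le_bound[OF \<omega> N \<kappa>]
  show ?case by (cases "dr N \<omega> \<kappa>") auto
qed

text \<open>Weak duality at \<open>e = \<kappa> / N\<close>. Replacing \<open>d / e\<close> by
  \<open>a / \<kappa>\<close> costs \<open>(N / \<kappa>) * (d - a / N)\<close>, which is where the
  factor \<open>N / \<kappa>\<close> in front of \<open>u\<close> arises.\<close>

lemma dr_le_dual_value:
  assumes P: "P \<in> \<Q>" and \<omega>: "\<omega> \<in> space M" and N: "N \<ge> 1" and \<kappa>: "0 < \<kappa>"
    and u: "approx N \<omega> P u" and c: "0 < c" "\<And>x. c \<le> l - \<kappa> / real N * \<phi> x"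
  shows "dr N \<omega> \<kappa> \<le> ereal (dual_value (f P) \<phi> (\<kappa> / real N) l + real N / \<kappa> * u)"
proof (rule dr_expectation_le[OF \<kappa> alpha_nonneg[OF \<omega> N]])
  fix Q a assume Q: "Q \<in> \<Q>" and a: "alpha N \<omega> Q = ereal a"
  obtain d where d: "KL (f P) (f Q) = ereal d" "\<bar>a / real N - d\<bar> \<le> u"
    by (rule approx_alphaD[OF u Q a N])
  have "mean Q - d / (\<kappa> / real N) \<le> dual_value (f P) \<phi> (\<kappa> / real N) l"
    unfolding mean_def
    by (rule expectation_minus_KL_le_dual_value[OF density[OF P] density[OF Q] d(1) \<phi> B c])
       (use N \<kappa> in auto)
  moreover have "d / (\<kappa> / real N) - a / \<kappa> \<le> real N / \<kappa> * u"
  proof -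
    have "real N / \<kappa> * (d - a / real N) \<le> real N / \<kappa> * u"
      using d(2) N \<kappa> by (intro mult_left_mono) auto
    moreover have "real N / \<kappa> * (d - a / real N) = d / (\<kappa> / real N) - a / \<kappa>"
      using N \<kappa> by (simp add: field_simps)
    ultimately show ?thesis by linarith
  qed
  ultimately show "prob_space.expectation Q (\<lambda>\<omega>. \<phi> (X \<omega>)) - a / \<kappa>
      \<le> dual_value (f P) \<phi> (\<kappa> / real N) l + real N / \<kappa> * u"
    unfolding expectation_eq_mean[OF Q] by linarith
qed

text \<open>The tilted measure is a single candidate in the supremum. Its relative entropy is
  finite, so \<open>approx\<close> makes its divergence finite as well.\<close>

lemma dr_ge_tilted:
  assumes P: "P \<in> \<Q>" and Q: "Q \<in> \<Q>" and \<omega>: "\<omega> \<in> space M" and N: "N \<ge> 1" and \<kappa>: "0 < \<kappa>"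
    and u: "approx N \<omega> P u" and c: "0 < c" "\<And>x. c \<le> l - \<kappa> / real N * \<phi> x"
    and tilt: "AE x in lborel. f Q x = f P x / (l - \<kappa> / real N * \<phi> x)"
  shows "ereal (dual_value (f P) \<phi> (\<kappa> / real N) l - real N / \<kappa> * u) \<le> dr N \<omega> \<kappa>"
proof -
  have e: "0 < \<kappa> / real N" using N \<kappa> by simp
  obtain d where d: "KL (f P) (f Q) = ereal d"
      "mean Q - d / (\<kappa> / real N) = dual_value (f P) \<phi> (\<kappa> / real N) l"
    unfolding mean_def
    by (rule tilted_density_attains_dual_value[OF density[OF P] density[OF Q] \<phi> B c e tilt])
  obtain a where a: "alpha N \<omega> Q = ereal a" "\<bar>a / real N - d\<bar> \<le> u"
    by (rule approx_KLD[OF u Q d(1) N])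
  have "real N / \<kappa> * (a / real N - d) \<le> real N / \<kappa> * u"
    using a(2) N \<kappa> by (intro mult_left_mono) auto
  moreover have "real N / \<kappa> * (a / real N - d) = a / \<kappa> - d / (\<kappa> / real N)"
    using N \<kappa> by (simp add: field_simps)
  ultimately have "dual_value (f P) \<phi> (\<kappa> / real N) l - real N / \<kappa> * u \<le> mean Q - a / \<kappa>"
    unfolding d(2)[symmetric] by linarith
  moreover have "ereal (mean Q - a / \<kappa>) \<le> dr N \<omega> \<kappa>"
    by (rule dr_ge[OF Q a(1)])
  ultimately show ?thesis by (meson ereal_less_eq(3) order_trans)
qed

lemma mean_le_KL:
  assumes P: "P \<in> \<Q>" and Q: "Q \<in> \<Q>" and d: "KL (f P) (f Q) = ereal d"
    and e: "0 < e" "4 * e * B \<le> 1"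
  shows "\<bar>mean Q - mean P\<bar> \<le> d / e + (e / 2 * var P + 16 * B^3 * e\<^sup>2)"
proof -
  note le = expectation_le_mean_plus_KL[OF density[OF P] density[OF Q] d]
  have "mean Q \<le> mean P + d / e + (e / 2 * var P + 16 * B^3 * e\<^sup>2)"
    using le[OF \<phi> B e] unfolding var_def mean_def .
  moreover have "- mean Q \<le> - mean P + d / e + (e / 2 * var P + 16 * B^3 * e\<^sup>2)"
  \<comment> \<open>Negating \<phi> preserves the bound \<open>B\<close> and the variance, and turns
    the one-sided estimate into the opposite one.\<close>
  proof -
    have "(\<lambda>x. - \<phi> x) \<in> borel_measurable borel" using \<phi> by simp
    moreover have "\<bar>- \<phi> x\<bar> \<le> B" for x using B by simp
    moreover have "(- \<phi> x + mean P)\<^sup>2 = (\<phi> x - mean P)\<^sup>2" for x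
      by (simp add: power2_eq_square algebra_simps)
    ultimately show ?thesis using le[of "\<lambda>x. - \<phi> x" B e] e by (simp add: mean_def var_def)
  qed
  ultimately show ?thesis by linarith
qed

text \<open>Since \<open>\<alpha> \<ge> 0\<close>, a penalty \<open>\<alpha> / \<kappa>\<close> with \<open>\<kappa> \<le> N e\<close> dominates \<open>\<alpha> / (N e)\<close>; this keeps the error
  \<open>u / e\<close> bounded however small \<open>\<kappa>\<close> is.\<close>

lemma dr_close_to_mean:
  assumes P: "P \<in> \<Q>" and \<omega>: "\<omega> \<in> space M" and N: "N \<ge> 1" and \<kappa>: "0 < \<kappa>"
    and u: "approx N \<omega> P u" and e: "0 < e" "4 * e * B \<le> 1" "\<kappa> / real N \<le> e"
  shows "\<bar>dr N \<omega> \<kappa> - ereal (mean P)\<bar> \<le> ereal (u / e + (e / 2 * var P + 16 * B^3 * e\<^sup>2))"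
    (is "_ \<le> ereal ?t")
proof -
  have "dr N \<omega> \<kappa> \<le> ereal (mean P + ?t)"
  proof (rule dr_expectation_le[OF \<kappa> alpha_nonneg[OF \<omega> N]])
    fix Q a assume Q: "Q \<in> \<Q>" and a: "alpha N \<omega> Q = ereal a"
    obtain d where d: "KL (f P) (f Q) = ereal d" "\<bar>a / real N - d\<bar> \<le> u"
      by (rule approx_alphaD[OF u Q a N])
    have "0 \<le> a" using alpha_nonneg[OF \<omega> N Q] a by simp
    have "(d - u) / e \<le> (a / real N) / e" using d(2) e(1) by (intro divide_right_mono) auto
    also have "(a / real N) / e = a / (real N * e)" by simp
    also have "\<dots> \<le> a / \<kappa>"
      using \<open>0 \<le> a\<close> \<kappa> e N by (intro divide_left_mono) (auto simp: field_simps)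
    finally have "d / e - u / e \<le> a / \<kappa>" by (simp add: diff_divide_distrib)
    then show "prob_space.expectation Q (\<lambda>\<omega>. \<phi> (X \<omega>)) - a / \<kappa> \<le> mean P + ?t"
      using mean_le_KL[OF P Q d(1) e(1,2)] unfolding expectation_eq_mean[OF Q] by linarith
  qed
  \<comment> \<open>The candidate \<open>P\<close> would cost \<open>\<alpha>(P) / \<kappa>\<close>,
    for which \<open>approx\<close> only offers \<open>u * N / \<kappa>\<close>, useless for small
    \<open>\<kappa>\<close>. The maximiser has penalty 0, and its relative entropy of at most
    \<open>u\<close> keeps its mean near \<open>mean P\<close>.\<close>
  moreover have "ereal (mean P - ?t) \<le> dr N \<omega> \<kappa>"
  proof -
    obtain Qh where Qh: "Qh \<in> \<Q>"
      "\<And>Q. Q \<in> \<Q> \<Longrightarrow> likelihood f N (sample Xs N \<omega>) Q \<le> likelihood f N (sample Xs N \<omega>) Qh"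
      using maximizer[OF \<omega> N] by blast
    \<comment> \<open>Here \<open>KL_refl\<close> provides the finite divergence which shows that
      the maximal likelihood is positive.\<close>
    obtain a where "alpha N \<omega> P = ereal a" by (rule approx_KLD[OF u P KL_refl N])
    then have 0: "alpha N \<omega> Qh = ereal 0"
      using divergence_maximizer_eq_0[of \<Q> f Qh N "sample Xs N \<omega>" P a] density_nonneg Qh P
      unfolding zero_ereal_def by blast
    obtain d where d: "KL (f P) (f Qh) = ereal d" "\<bar>0 / real N - d\<bar> \<le> u"
      by (rule approx_alphaD[OF u Qh(1) 0 N])
    have "d / e \<le> u / e" using d(2) e(1) by (intro divide_right_mono) auto
    then have "mean P - ?t \<le> mean Qh" using mean_le_KL[OF P Qh(1) d(1) e(1,2)] by linarith
    moreover have "ereal (mean Qh) \<le> dr N \<omega> \<kappa>"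
      using dr_ge[OF Qh(1) 0, of \<kappa>] by simp
    ultimately show ?thesis by (meson ereal_less_eq(3) order_trans)
  qed
  ultimately show ?thesis by (cases "dr N \<omega> \<kappa>") auto
qed

section \<open>Consistency from the GCD property\<close>

lemma GCD_class_approx:
  assumes gcd: "GCD_class \<Q> Xs f" and P: "P \<in> \<Q>"
  obtains U where "bigO_P P U (\<lambda>N. real N powr (-1/2))"
    "\<And>N \<omega> u. N \<ge> 1 \<Longrightarrow> \<omega> \<in> space P \<Longrightarrow> U N \<omega> \<le> ereal u \<Longrightarrow> approx N \<omega> P u"
proof -
  obtain U where U: "bigO_P P U (\<lambda>N. real N powr (-1/2))"
    and env: "\<forall>N\<ge>1. measurable_envelope P
       (\<lambda>\<omega>. SUP Q\<in>\<Q>. ext_dist (alpha N \<omega> Q / ereal (real N)) (KL (f P) (f Q))) (U N)"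
    using gcd P unfolding GCD_class_def by blast
  have "approx N \<omega> P u" if "N \<ge> 1" "\<omega> \<in> space P" "U N \<omega> \<le> ereal u" for N \<omega> u
    unfolding approx_def
  proof
    fix Q assume "Q \<in> \<Q>"
    then have "ext_dist (alpha N \<omega> Q / ereal (real N)) (KL (f P) (f Q))
        \<le> (SUP Q\<in>\<Q>. ext_dist (alpha N \<omega> Q / ereal (real N)) (KL (f P) (f Q)))"
      by (rule SUP_upper)
    also have "\<dots> \<le> U N \<omega>" using env that(1,2) unfolding measurable_envelope_def by blast
    finally show "ext_dist (alpha N \<omega> Q / ereal (real N)) (KL (f P) (f Q)) \<le> ereal u"
      using that(3) by (rule order_trans)
  qed
  with U show ?thesis by (rule that)
qed

lemma eventually_small_ratio:
  assumes k: "k \<in> o(\<lambda>N. real N)" and e: "0 < e"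
  shows "\<forall>\<^sub>F N in sequentially. N \<ge> 1 \<and> k N / real N \<le> e"
proof -
  have "(\<lambda>N. k N / real N) \<longlonglongrightarrow> 0" by (rule smalloD_tendsto[OF k])
  then have "\<forall>\<^sub>F N in sequentially. k N / real N < e" using e by (rule order_tendstoD)
  with eventually_ge_at_top[of "1::nat"] show ?thesis by eventually_elim auto
qed

lemma eventually_small_ratio_bound:
  assumes k: "k \<in> o(\<lambda>N. real N)"
  shows "\<forall>\<^sub>F N in sequentially. N \<ge> 1 \<and> 4 * (k N / real N) * B \<le> 1"
proof -
  have B0: "0 \<le> B" using B[of 0] by linarith
  \<comment> \<open>The added 1 avoids division by zero when \<open>B = 0\<close>.\<close>
  have "0 < 1 / (4 * B + 1)" using B0 by simp
  from eventually_small_ratio[OF k this] show ?thesis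
  proof eventually_elim
    case (elim N)
    then have "k N / real N * (4 * B) \<le> 1 / (4 * B + 1) * (4 * B)"
      using B0 by (intro mult_right_mono) auto
    also have "\<dots> \<le> 1" using B0 by simp
    finally show ?case using elim by (simp add: mult_ac)
  qed
qed

text \<open>A scale \<open>e\<close> is fixed independently of \<open>N\<close>, small enough for
  the deterministic error to stay below \<eta>/2. For large \<open>N\<close> a deviation above
  \<eta> then forces \<open>U\<close> above a fixed \<open>\<delta>\<close>, an event of vanishing
  outer measure.\<close>

lemma dr_consistent:
  assumes gcd: "GCD_class \<Q> Xs f" and P: "P \<in> \<Q>"
    and k_pos: "\<And>N. N \<ge> 1 \<Longrightarrow> k N > 0" and k_small: "k \<in> o(\<lambda>N. real N)"
  shows "tendsto_in_prob P (\<lambda>N \<omega>. dr N \<omega> (k N)) (mean P)"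
  unfolding tendsto_in_prob_def
proof (intro allI impI)
  fix \<eta> :: real assume \<eta>: "0 < \<eta>"
  obtain U where U: "bigO_P P U (\<lambda>N. real N powr (-1/2))"
    "\<And>N \<omega> u. N \<ge> 1 \<Longrightarrow> \<omega> \<in> space P \<Longrightarrow> U N \<omega> \<le> ereal u \<Longrightarrow> approx N \<omega> P u"
    using GCD_class_approx[OF gcd P] by blast
  have "((\<lambda>e. e / 2 * var P + 16 * B^3 * e\<^sup>2) \<longlongrightarrow> 0) (at_right 0)"
    by (auto intro!: tendsto_eq_intros)
  then have "\<forall>\<^sub>F e in at_right 0. e / 2 * var P + 16 * B^3 * e\<^sup>2 < \<eta> / 2"
    using \<eta> by (intro order_tendstoD) auto
  moreover have "((\<lambda>e. 4 * e * B) \<longlongrightarrow> 0) (at_right 0)"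
    by (auto intro!: tendsto_eq_intros)
  then have "\<forall>\<^sub>F e in at_right 0. 4 * e * B < 1" by (intro order_tendstoD) auto
  moreover have "\<forall>\<^sub>F e in at_right (0::real). 0 < e" by (simp add: eventually_at_right_less)
  ultimately have "\<forall>\<^sub>F e in at_right 0. e / 2 * var P + 16 * B^3 * e\<^sup>2 < \<eta> / 2 \<and> 4 * e * B < 1 \<and> 0 < e"
    by eventually_elim auto
  then obtain e where e: "e / 2 * var P + 16 * B^3 * e\<^sup>2 < \<eta> / 2" "4 * e * B < 1" "0 < e"
    using eventually_happens'[OF trivial_limit_at_right_real] by blast
  \<comment> \<open>Chosen so that the stochastic error \<open>\<delta> / e\<close> uses up the
    other half of \<eta>.\<close>
  define \<delta> where "\<delta> = e * \<eta> / 2"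
  have \<delta>: "0 < \<delta>" "\<delta> / e = \<eta> / 2" using e \<eta> by (auto simp: \<delta>_def)
  show "(\<lambda>N. outer_measure_of P {\<omega>\<in>space P. \<bar>dr N \<omega> (k N) - ereal (mean P)\<bar> > ereal \<eta>}) \<longlonglongrightarrow> 0"
  proof (rule tendsto_sandwich[OF _ _ tendsto_const bigO_P_imp_tendsto_0[OF U(1) \<delta>(1)]])
    show "\<forall>\<^sub>F N in sequentially. outer_measure_of P {\<omega>\<in>space P. \<bar>dr N \<omega> (k N) - ereal (mean P)\<bar> > ereal \<eta>}
        \<le> outer_measure_of P {\<omega>\<in>space P. U N \<omega> > ereal \<delta>}"
      using eventually_small_ratio[OF k_small e(3)]
    proof eventually_elim
      case (elim N)
      have "\<bar>dr N \<omega> (k N) - ereal (mean P)\<bar> \<le> ereal \<eta>"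
        if \<omega>: "\<omega> \<in> space P" and le: "U N \<omega> \<le> ereal \<delta>" for \<omega>
      proof -
        have "\<bar>dr N \<omega> (k N) - ereal (mean P)\<bar> \<le> ereal (\<delta> / e + (e / 2 * var P + 16 * B^3 * e\<^sup>2))"
          using \<omega> elim e k_pos[of N] U(2)[of N \<omega> \<delta>] le
          by (intro dr_close_to_mean[OF P]) (auto simp: space_eq[OF P])
        also have "\<dots> \<le> ereal \<eta>" unfolding \<delta>(2) using e(1) by simp
        finally show ?thesis .
      qed
      then show ?case unfolding not_le[symmetric] by (intro outer_measure_of_mono) blast
    qed
  qed (rule always_eventually, rule allI, rule zero_le)
qed

section \<open>Upper expansion and the equality case\<close>

lemma dr_upper_expansion:
  assumes gcd: "GCD_class \<Q> Xs f" and P: "P \<in> \<Q>"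
    and k_pos: "\<And>N. N \<ge> 1 \<Longrightarrow> k N > 0" and k_small: "k \<in> o(\<lambda>N. real N)"
  shows "\<exists>(r :: nat \<Rightarrow> real) (R :: nat \<Rightarrow> 'a \<Rightarrow> real).
        r \<in> O(\<lambda>N. (k N / real N)\<^sup>2) \<and>
        bigO_P P (\<lambda>N \<omega>. ereal (R N \<omega>)) (\<lambda>N. sqrt (real N) / k N) \<and>
        (\<forall>N\<ge>1. AE \<omega> in P. dr N \<omega> (k N)
             \<le> ereal (mean P + k N / real N * (1 / 2) * var P + r N + R N \<omega>))"
proof -
  obtain U where U: "bigO_P P U (\<lambda>N. real N powr (-1/2))"
    "\<And>N \<omega> u. N \<ge> 1 \<Longrightarrow> \<omega> \<in> space P \<Longrightarrow> U N \<omega> \<le> ereal u \<Longrightarrow> approx N \<omega> P u"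
    using GCD_class_approx[OF gcd P] by blast
  define r where "r N = 16 * B^3 * (k N / real N)\<^sup>2" for N
  define T where "T N = mean P + k N / real N * (1 / 2) * var P + r N" for N
  \<comment> \<open>As a positive part, \<open>R\<close> makes the inequality hold for every
    \<open>N\<close>, and all content moves into its order. The default 0 is harmless:
    \<open>dr\<close> can only be infinite as \<open>-\<infinity>\<close>.\<close>
  define R where "R N \<omega> = (if \<bar>dr N \<omega> (k N)\<bar> = \<infinity> then 0 else max 0 (real_of_ereal (dr N \<omega> (k N)) - T N))"
    for N \<omega>
  have "r \<in> O(\<lambda>N. (k N / real N)\<^sup>2)" unfolding r_def[abs_def] by simp
  moreover have "bigO_P P (\<lambda>N \<omega>. ereal (R N \<omega>)) (\<lambda>N. sqrt (real N) / k N)"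
  proof (rule bigO_P_dominated[OF U(1) k_pos])
    show "\<forall>\<^sub>F N in sequentially. \<forall>\<omega>\<in>space P. \<forall>u. U N \<omega> \<le> ereal u \<longrightarrow> \<bar>R N \<omega>\<bar> \<le> real N / k N * u"
      using eventually_small_ratio_bound[OF k_small]
    proof eventually_elim
      case (elim N)
      define e where "e = k N / real N"
      have e: "0 < e" "4 * e * B \<le> 1" using elim k_pos[of N] by (auto simp: e_def)
      have m: "\<bar>e * mean P\<bar> \<le> e * B" using mean_le[OF P] e by (simp add: abs_mult)
      have "\<bar>e * \<phi> x\<bar> \<le> e * B" for x using B[of x] e by (simp add: abs_mult)
      then have c: "1 / 2 \<le> 1 + e * mean P - e * \<phi> x" for x
        using m e(2) abs_le_D1[of "e * \<phi> x" "e * B"] abs_le_D2[of "e * mean P" "e * B"] by fastforce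
      have dual: "dual_value (f P) \<phi> e (1 + e * mean P) \<le> T N"
        using dual_value_expansion[OF density[OF P] \<phi> B e, of "1 + e * mean P"] m
        unfolding T_def r_def e_def[symmetric] mean_def[symmetric] var_def[symmetric] by simp
      show ?case
      proof (intro ballI allI impI)
        fix \<omega> u assume \<omega>: "\<omega> \<in> space P" and le: "U N \<omega> \<le> ereal u"
        have u: "approx N \<omega> P u" using U(2) \<omega> le elim by blast
        have "dr N \<omega> (k N) \<le> ereal (dual_value (f P) \<phi> e (1 + e * mean P) + real N / k N * u)"
          unfolding e_def
          by (rule dr_le_dual_value[OF P _ _ _ u, of _ "1 / 2"])
             (use \<omega> elim k_pos[of N] c in \<open>auto simp: space_eq[OF P] e_def\<close>)
        also have "\<dots> \<le> ereal (T N + real N / k N * u)" using dual by simp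
        finally have "dr N \<omega> (k N) \<le> ereal (T N + real N / k N * u)" .
        \<comment> \<open>Covers the samples on which the positive part is 0.\<close>
        moreover have "0 \<le> real N / k N * u"
          using approx_nonneg[OF u P] elim k_pos[of N] by simp
        ultimately show "\<bar>R N \<omega>\<bar> \<le> real N / k N * u"
          by (cases "dr N \<omega> (k N)") (auto simp: R_def)
      qed
    qed
  qed
  moreover have "AE \<omega> in P. dr N \<omega> (k N)
      \<le> ereal (mean P + k N / real N * (1 / 2) * var P + r N + R N \<omega>)" if N: "N \<ge> 1" for N
    using AE_space
  proof eventually_elim
    case (elim \<omega>)
    then have "dr N \<omega> (k N) \<le> ereal B"
      using dr_le_bound[OF _ N k_pos[OF N]] space_eq[OF P] by simp
    then have "dr N \<omega> (k N) \<le> ereal (T N + R N \<omega>)"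
      by (cases "dr N \<omega> (k N)") (auto simp: R_def)
    then show ?case by (simp add: T_def)
  qed
  ultimately show ?thesis by blast
qed

text \<open>The tilting hypothesis prescribes only the law of \<open>X\<close>; uniqueness of
  densities carries it over to the fixed version \<open>f Q\<close>, almost everywhere.\<close>

lemma distributed_density_unique:
  assumes "Q \<in> \<Q>" and D: "distributed Q lborel X (\<lambda>x. ennreal (g x))" and "\<And>x. 0 \<le> g x"
  shows "AE x in lborel. f Q x = g x"
proof -
  have F: "distributed Q lborel X (\<lambda>x. ennreal (f Q x))"
    using family assms(1) by (auto simp: iid_family_def)
  have "density lborel (\<lambda>x. ennreal (f Q x)) = density lborel (\<lambda>x. ennreal (g x))"
    using distributed_distr_eq_density[OF D] distributed_distr_eq_density[OF F] by metis
  then have "AE x in lborel. ennreal (f Q x) = ennreal (g x)"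
    by (rule sigma_finite_measure.density_unique[OF lborel.sigma_finite_measure_axioms, rotated 2])
       (use D F in \<open>auto simp: distributed_def\<close>)
  then show ?thesis
    by eventually_elim (use assms(3) density_nonneg[OF assms(1)] in simp)
qed

text \<open>The dual value \<open>D N\<close> separates the errors: \<open>r\<close> compares it
  with the expansion and is deterministic, while \<open>R\<close> compares \<open>dr\<close> with it
  and is squeezed by duality from above and by the tilted candidate from below.\<close>

lemma dr_tilted_expansion:
  assumes gcd: "GCD_class \<Q> Xs f" and P: "P \<in> \<Q>"
    and k_pos: "\<And>N. N \<ge> 1 \<Longrightarrow> k N > 0" and k_small: "k \<in> o(\<lambda>N. real N)"
    and tilt: "\<forall>\<^sub>F N in sequentially. \<exists>l. l > k N / real N * (SUP x. \<phi> x) \<and>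
           (\<exists>P'\<in>\<Q>. distributed P' lborel X (\<lambda>x. ennreal (f P x / (l - k N / real N * \<phi> x))))"
  shows "\<exists>(r :: nat \<Rightarrow> real) (R :: nat \<Rightarrow> 'a \<Rightarrow> real).
        r \<in> O(\<lambda>N. (k N / real N)\<^sup>2) \<and>
        bigO_P P (\<lambda>N \<omega>. ereal (R N \<omega>)) (\<lambda>N. sqrt (real N) / k N) \<and>
        (\<forall>N\<ge>1. AE \<omega> in P. dr N \<omega> (k N)
             = ereal (mean P + k N / real N * (1 / 2) * var P + r N + R N \<omega>))"
proof -
  obtain U where U: "bigO_P P U (\<lambda>N. real N powr (-1/2))"
    "\<And>N \<omega> u. N \<ge> 1 \<Longrightarrow> \<omega> \<in> space P \<Longrightarrow> U N \<omega> \<le> ereal u \<Longrightarrow> approx N \<omega> P u"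
    using GCD_class_approx[OF gcd P] by blast
  define good where "good N l Q \<longleftrightarrow> l > k N / real N * (SUP x. \<phi> x) \<and> Q \<in> \<Q> \<and>
    distributed Q lborel X (\<lambda>x. ennreal (f P x / (l - k N / real N * \<phi> x)))" for N l Q
  \<comment> \<open>An arbitrary value for the finitely many \<open>N\<close> that may lack a tilted
    measure; only eventual bounds use \<open>good\<close>.\<close>
  define l where "l N = (SOME l. \<exists>Q. good N l Q)" for N
  define D where "D N = dual_value (f P) \<phi> (k N / real N) (l N)" for N
  define r where "r N = D N - (mean P + k N / real N / 2 * var P)" for N
  define R where "R N \<omega> = real_of_ereal (dr N \<omega> (k N)) - D N" for N \<omega>
  have ev: "\<forall>\<^sub>F N in sequentially. N \<ge> 1 \<and> 4 * (k N / real N) * B \<le> 1 \<and> (\<exists>Q. good N (l N) Q)"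
    using tilt eventually_small_ratio_bound[OF k_small]
  proof eventually_elim
    case (elim N)
    then have "\<exists>l Q. good N l Q" by (auto simp: good_def)
    then have "\<exists>Q. good N (l N) Q" unfolding l_def by (rule someI_ex)
    with elim show ?case by blast
  qed
  have goodD: "\<exists>c>0. (\<forall>x. c \<le> l - k N / real N * \<phi> x) \<and>
      (AE x in lborel. f Q x = f P x / (l - k N / real N * \<phi> x))"
    if good: "good N l Q" and N: "N \<ge> 1" for N l Q
  proof -
    \<comment> \<open>The strict gap above the supremum is the uniform positive lower bound that the
      duality lemmas require.\<close>
    define c where "c = l - k N / real N * (SUP x. \<phi> x)"
    have "bdd_above (range \<phi>)" using B by (auto intro!: bdd_aboveI[of _ B] simp: abs_le_iff)
    then have "\<phi> x \<le> (SUP x. \<phi> x)" for x by (intro cSUP_upper) auto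
    then have "k N / real N * \<phi> x \<le> k N / real N * (SUP x. \<phi> x)" for x
      using k_pos[OF N] by (intro mult_left_mono) auto
    then have c: "c \<le> l - k N / real N * \<phi> x" for x unfolding c_def by simp
    moreover have c0: "0 < c" using good by (simp add: c_def good_def)
    moreover have "AE x in lborel. f Q x = f P x / (l - k N / real N * \<phi> x)"
    proof (rule distributed_density_unique)
      show "0 \<le> f P x / (l - k N / real N * \<phi> x)" for x
        using c[of x] c0 density_nonneg[OF P] by (intro divide_nonneg_nonneg) auto
    qed (use good in \<open>auto simp: good_def\<close>)
    ultimately show ?thesis by blast
  qed
  have "r \<in> O(\<lambda>N. (k N / real N)\<^sup>2)"
  proof (rule bigoI[where c = "16 * B^3"])
    show "\<forall>\<^sub>F N in sequentially. norm (r N) \<le> 16 * B^3 * norm ((k N / real N)\<^sup>2)"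
      using ev
    proof eventually_elim
      case (elim N)
      then obtain Q where good: "good N (l N) Q" and N: "N \<ge> 1" by blast
      then have Q: "Q \<in> \<Q>" by (simp add: good_def)
      obtain c where c: "0 < c" "\<And>x. c \<le> l N - k N / real N * \<phi> x"
        and tl: "AE x in lborel. f Q x = f P x / (l N - k N / real N * \<phi> x)"
        using goodD[OF good N] by blast
      have e: "0 < k N / real N" "4 * (k N / real N) * B \<le> 1" using elim k_pos[of N] by auto
      show ?case
        using tilted_dual_value_expansion[OF density[OF P] density[OF Q] \<phi> B c e tl]
        unfolding r_def D_def mean_def[symmetric] var_def[symmetric] by simp
    qed
  qed
  moreover have "bigO_P P (\<lambda>N \<omega>. ereal (R N \<omega>)) (\<lambda>N. sqrt (real N) / k N)"
  proof (rule bigO_P_dominated[OF U(1) k_pos])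
    show "\<forall>\<^sub>F N in sequentially. \<forall>\<omega>\<in>space P. \<forall>u. U N \<omega> \<le> ereal u \<longrightarrow> \<bar>R N \<omega>\<bar> \<le> real N / k N * u"
      using ev
    proof eventually_elim
      case (elim N)
      then obtain Q where good: "good N (l N) Q" and N: "N \<ge> 1" by blast
      then have Q: "Q \<in> \<Q>" by (simp add: good_def)
      obtain c where c: "0 < c" "\<And>x. c \<le> l N - k N / real N * \<phi> x"
        and tl: "AE x in lborel. f Q x = f P x / (l N - k N / real N * \<phi> x)"
        using goodD[OF good N] by blast
      show ?case
      proof (intro ballI allI impI)
        fix \<omega> u assume \<omega>: "\<omega> \<in> space P" and le: "U N \<omega> \<le> ereal u"
        have u: "approx N \<omega> P u" by (rule U(2)[OF N \<omega> le])
        have \<omega>M: "\<omega> \<in> space M" using \<omega> space_eq[OF P] by simp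
        show "\<bar>R N \<omega>\<bar> \<le> real N / k N * u"
          using dr_le_dual_value[OF P \<omega>M N k_pos[OF N] u c] dr_ge_tilted[OF P Q \<omega>M N k_pos[OF N] u c tl]
          by (cases "dr N \<omega> (k N)") (auto simp: R_def D_def)
      qed
    qed
  qed
  moreover have "AE \<omega> in P. dr N \<omega> (k N)
      = ereal (mean P + k N / real N * (1 / 2) * var P + r N + R N \<omega>)" if N: "N \<ge> 1" for N
    \<comment> \<open>Equality holds only almost surely because \<open>real_of_ereal\<close> in
      \<open>R\<close> loses an infinite \<open>dr\<close>.\<close>
    using AE_dr_finite[OF P N k_pos[OF N]]
  proof eventually_elim
    case (elim \<omega>)
    show ?case by (subst elim) (simp add: r_def R_def)
  qed
  ultimately show ?thesis by blast
qed

end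

theorem theorem2:
  fixes M :: "'a measure" and \<Q> :: "'a measure set"
    and X :: "'a \<Rightarrow> real" and Xs :: "nat \<Rightarrow> 'a \<Rightarrow> real"
    and f :: "'a measure \<Rightarrow> real \<Rightarrow> real"
    and k :: "nat \<Rightarrow> real" and \<phi> :: "real \<Rightarrow> real"
  assumes family: "iid_family M \<Q> X Xs f"
    and mle: "mle_exists M \<Q> Xs f"
    and gcd: "GCD_class \<Q> Xs f"
    and k_pos: "\<And>N. N \<ge> 1 \<Longrightarrow> k N > 0"
    and k_small: "k \<in> o(\<lambda>N. real N)"
    and \<phi>_measurable: "\<phi> \<in> borel_measurable borel"
    and \<phi>_bounded: "bounded (range \<phi>)"
  shows
    "(\<forall>P\<in>\<Q>. tendsto_in_prob P
        (\<lambda>N \<omega>. dr_expectation \<Q> f N (sample Xs N \<omega>) (k N) (\<lambda>\<omega>. \<phi> (X \<omega>)))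
        (prob_space.expectation P (\<lambda>\<omega>. \<phi> (X \<omega>)))) \<and>
     (\<forall>P\<in>\<Q>. \<exists>(r :: nat \<Rightarrow> real) (R :: nat \<Rightarrow> 'a \<Rightarrow> real).
        r \<in> O(\<lambda>N. (k N / real N)\<^sup>2) \<and>
        bigO_P P (\<lambda>N \<omega>. ereal (R N \<omega>)) (\<lambda>N. sqrt (real N) / k N) \<and>
        (\<forall>N\<ge>1. AE \<omega> in P.
           dr_expectation \<Q> f N (sample Xs N \<omega>) (k N) (\<lambda>\<omega>. \<phi> (X \<omega>))
             \<le> ereal (prob_space.expectation P (\<lambda>\<omega>. \<phi> (X \<omega>))
                 + k N / real N * (1 / 2) * prob_space.variance P (\<lambda>\<omega>. \<phi> (X \<omega>))
                 + r N + R N \<omega>))) \<and>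
     (\<forall>P\<in>\<Q>.
        (\<forall>\<^sub>F N in sequentially. \<exists>l. l > k N / real N * (SUP x. \<phi> x) \<and>
           (\<exists>P'\<in>\<Q>. distributed P' lborel X
              (\<lambda>x. ennreal (f P x / (l - k N / real N * \<phi> x))))) \<longrightarrow>
        (\<exists>(r :: nat \<Rightarrow> real) (R :: nat \<Rightarrow> 'a \<Rightarrow> real).
           r \<in> O(\<lambda>N. (k N / real N)\<^sup>2) \<and>
           bigO_P P (\<lambda>N \<omega>. ereal (R N \<omega>)) (\<lambda>N. sqrt (real N) / k N) \<and>
           (\<forall>N\<ge>1. AE \<omega> in P.
              dr_expectation \<Q> f N (sample Xs N \<omega>) (k N) (\<lambda>\<omega>. \<phi> (X \<omega>))
                = ereal (prob_space.expectation P (\<lambda>\<omega>. \<phi> (X \<omega>))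
                    + k N / real N * (1 / 2) * prob_space.variance P (\<lambda>\<omega>. \<phi> (X \<omega>))
                    + r N + R N \<omega>))))"
proof -
  obtain B where "\<And>x. \<bar>\<phi> x\<bar> \<le> B"
    using \<phi>_bounded by (auto simp: bounded_iff)
  then interpret bounded_mle_family M \<Q> X Xs f \<phi> B
    by unfold_locales (use family mle \<phi>_measurable in auto)
  have "tendsto_in_prob P
        (\<lambda>N \<omega>. dr_expectation \<Q> f N (sample Xs N \<omega>) (k N) (\<lambda>\<omega>. \<phi> (X \<omega>)))
        (prob_space.expectation P (\<lambda>\<omega>. \<phi> (X \<omega>)))" if P: "P \<in> \<Q>" for P
    unfolding expectation_eq_mean[OF P] by (rule dr_consistent[OF gcd P k_pos k_small])
  then show ?thesis
  proof (intro conjI ballI impI, goal_cases)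
    case (2 P)
    show ?case
      unfolding variance_eq_var[OF 2(2)] expectation_eq_mean[OF 2(2)]
      by (rule dr_upper_expansion[OF gcd 2(2) k_pos k_small])
  next
    case (3 P)
    show ?case
      unfolding variance_eq_var[OF 3(2)] expectation_eq_mean[OF 3(2)]
      by (rule dr_tilted_expansion[OF gcd 3(2) k_pos k_small 3(3)])
  qed blast
qed

end
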